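(* Let $I$ be a non-degenerate interval and $f:I\to\mathbb{R}$ continuous. Let $D(f)$ be the set of points where $f$ has a derivative (finite or infinite) and $\mathsf{M}_1(f)$ the set of $\mathsf{M}_1$-points of $f$. Then there is a set $E\subseteq I$ with $\mathcal{H}^1(\{(x,f(x)):x\in E\})=0$ and $D(f)\subseteq\mathsf{M}_1(f)\subseteq D(f)\cup E$. In particular, $f$ is differentiable at almost every $\mathsf{M}_1$-point (in the sense of $\mathcal{H}^1$ on the graph).
   Context: $\mathcal{H}^1$ is one-dimensional Hausdorff measure in $\mathbb{R}^2$. With $\psi(x)=(x,f(x))$ and the Euclidean norm, $y\in I$ is an $\mathsf{M}_1$-point of $f$ if there is $\varepsilon>0$ such that $|\psi(x)-\psi(y)|\le|\psi(x)-\psi(z)|$ for all $x\in I\cap(y-\varepsilon,y)$ and $z\in I\cap(y,y+\varepsilon)$. *)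

theory Defs
  imports "HOL-Analysis.Analysis"
begin

text \<open>One-dimensional Hausdorff measure on the plane \<open>real \<times> real\<close> (Euclidean norm),
  normalised so that the 1-dimensional constant is 1:
  \<open>H1_delta d A = inf { \<Sum> diam(C i) : A \<subseteq> \<Union> C i, C i bounded, diam (C i) \<le> d }\<close>,
  \<open>H1 A = sup_{d>0} H1_delta d A\<close>. Boundedness is required because the library's
  \<open>diameter\<close> of an unbounded set is 0 (its true diameter is infinite).\<close>

definition H1_delta :: "real \<Rightarrow> (real \<times> real) set \<Rightarrow> ennreal" where
  "H1_delta d A = (INF C \<in> {C :: nat \<Rightarrow> (real \<times> real) set.
        A \<subseteq> (\<Union>i. C i) \<and> (\<forall>i. bounded (C i) \<and> diameter (C i) \<le> d)}.
        (\<Sum>i. ennreal (diameter (C i))))"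

definition hausdorff1 :: "(real \<times> real) set \<Rightarrow> ennreal" where
  "hausdorff1 A = (SUP d \<in> {0<..}. H1_delta d A)"

definition graph_map :: "(real \<Rightarrow> real) \<Rightarrow> real \<Rightarrow> real \<times> real" where
  "graph_map f x = (x, f x)"

definition deriv_points :: "(real \<Rightarrow> real) \<Rightarrow> real set \<Rightarrow> real set" where
  "deriv_points f I = {y \<in> I.
      (\<exists>d. (f has_real_derivative d) (at y within I))
    \<or> filterlim (\<lambda>x. (f x - f y) / (x - y)) at_top (at y within I)
    \<or> filterlim (\<lambda>x. (f x - f y) / (x - y)) at_bot (at y within I)}"

definition M1_points :: "(real \<Rightarrow> real) \<Rightarrow> real set \<Rightarrow> real set" where
  "M1_points f I = {y \<in> I. \<exists>\<epsilon>>0. \<forall>x \<in> I \<inter> {y - \<epsilon><..<y}. \<forall>z \<in> I \<inter> {y<..<y + \<epsilon>}.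
      norm (graph_map f x - graph_map f y) \<le> norm (graph_map f x - graph_map f z)}"

end

theory Submission
  imports Defs
begin

text \<open>
  Call the set of limit directions at \<open>P\<close> of points of a plane set \<open>G\<close>, scaled by arbitrary
  nonnegative factors, its contingent at \<open>P\<close>. The main step is a weak form of a theorem of Saks: for
  every plane set \<open>G\<close> the contingent is convex at almost every point of \<open>G\<close> in the sense of
  one-dimensional Hausdorff measure. Indeed, the points at which a given open cone of directions
  around \<open>c\<close> is missed form countably many pieces, each a Lipschitz graph over the line orthogonal to
  \<open>c\<close>. Almost every point \<open>P\<close> of such a piece has a tangent \<open>\<tau>\<close> along which the piece is dense, and
  the missed cones attached to the nearby points of the piece sweep out the whole open half-plane
  bounded by \<open>\<tau>\<close> that contains \<open>c\<close>. A missed direction can then not be a positive combination of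
  two contingent directions.

  At an \<open>M\<^sub>1\<close>-point \<open>y\<close> let \<open>L\<close> and \<open>R\<close> be the contingents of the left and right part of the graph.
  Letting \<open>z\<close> tend to \<open>y\<close> in the defining inequality gives \<open>u \<bullet> v \<le> 0\<close> for \<open>u \<in> L\<close>, \<open>v \<in> R\<close>, so
  the closed sets \<open>L\<close> and \<open>R\<close> meet only in 0. If \<open>L \<union> R\<close> is convex, the segment from \<open>u\<close> to \<open>v\<close>,
  being connected, must pass through 0. Hence \<open>L\<close> and \<open>R\<close> are opposite rays, and the derivative
  exists, possibly infinite.
\<close>

section \<open>Almost everywhere differentiability of Lipschitz functions\<close>

text \<open>Vitali's theorem for closed balls, with midpoint and half-length turning
  \<open>{a..b}\<close> into a \<open>cball\<close>. The closed intervals are disjoint, and already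
  the open ones exhaust \<open>S\<close> up to a null set, so that a second cover can be built
  inside their open union.\<close>

lemma Vitali_covering_intervals:
  fixes S U :: "real set"
  assumes "open U" "S \<subseteq> U"
    and fine: "\<And>x d. x \<in> S \<Longrightarrow> 0 < d \<Longrightarrow> \<exists>a b. a < b \<and> a \<le> x \<and> x \<le> b \<and> b - a < d \<and> P a b"
  obtains C where "countable C" "\<And>a b. (a, b) \<in> C \<Longrightarrow> a < b \<and> P a b \<and> {a..b} \<subseteq> U"
    "disjoint_family_on (\<lambda>(a, b). {a..b}) C" "negligible (S - (\<Union>(a, b)\<in>C. {a<..<b}))"
proof -
  define K where "K = {(a, b). a < b \<and> P a b \<and> {a..b} \<subseteq> U}"
  define m :: "real \<times> real \<Rightarrow> real" where "m = (\<lambda>(a, b). (a + b) / 2)"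
  define r :: "real \<times> real \<Rightarrow> real" where "r = (\<lambda>(a, b). (b - a) / 2)"
  have mr: "m (a, b) - r (a, b) = a" "m (a, b) + r (a, b) = b" for a b
    by (simp_all add: m_def r_def add_divide_distrib diff_divide_distrib)
  have cb: "cball (m i) (r i) = (case i of (a, b) \<Rightarrow> {a..b})" for i
    by (cases i) (simp add: cball_eq_atLeastAtMost mr)
  have bl: "ball (m i) (r i) = (case i of (a, b) \<Rightarrow> {a<..<b})" for i
    by (cases i) (simp add: ball_eq_greaterThanLessThan mr)
  have fine': "\<exists>i. i \<in> K \<and> x \<in> cball (m i) (r i) \<and> r i < d" if "x \<in> S" "0 < d" for x d
  proof -
    obtain e where e: "e > 0" "ball x e \<subseteq> U"
      by (rule openE[OF assms(1) subsetD[OF assms(2) \<open>x \<in> S\<close>]])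
    obtain a b where ab: "a < b" "a \<le> x" "x \<le> b" "b - a < min d e" "P a b"
      using fine[OF \<open>x \<in> S\<close>, of "min d e"] e \<open>0 < d\<close> by auto
    have "{a..b} \<subseteq> ball x e" using ab by (auto simp: dist_real_def)
    with e ab have "(a, b) \<in> K" by (auto simp: K_def)
    moreover have "x \<in> cball (m (a,b)) (r (a,b))" unfolding cb using ab by simp
    moreover have "r (a, b) < d" using ab by (simp add: r_def)
    ultimately show ?thesis by blast
  qed
  have rpos: "0 < r i" if "i \<in> K" for i
    using that by (auto simp: K_def r_def)
  obtain C where C: "countable C" "C \<subseteq> K"
     "pairwise (\<lambda>i j. disjnt (cball (m i) (r i)) (cball (m j) (r j))) C"
     "negligible (S - (\<Union>i \<in> C. cball (m i) (r i)))"
    by (rule Vitali_covering_theorem_cballs[of K r S m, OF rpos fine']) (assumption | rule that)+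
  \<comment> \<open>Passing from closed to open balls loses only countably many endpoints.\<close>
  have "negligible (\<Union>i\<in>C. sphere (m i) (r i))"
    using C(1) by (intro negligible_countable_Union) (auto intro: negligible_sphere)
  then have "negligible ((S - (\<Union>i \<in> C. cball (m i) (r i))) \<union> (\<Union>i\<in>C. sphere (m i) (r i)))"
    using C(4) by (rule negligible_Un[rotated])
  moreover have "S - (\<Union>i \<in> C. ball (m i) (r i)) \<subseteq> (S - (\<Union>i \<in> C. cball (m i) (r i))) \<union> (\<Union>i\<in>C. sphere (m i) (r i))"
    by force
  ultimately have neg: "negligible (S - (\<Union>i \<in> C. ball (m i) (r i)))"
    by (rule negligible_subset)
  show ?thesis
  proof (rule that[OF C(1)])
    show "a < b \<and> P a b \<and> {a..b} \<subseteq> U" if "(a, b) \<in> C" for a b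
      using C(2) that by (auto simp: K_def)
    show "disjoint_family_on (\<lambda>(a, b). {a..b}) C"
      using C(3) by (simp add: disjoint_family_on_def pairwise_def disjnt_def cb)
    show "negligible (S - (\<Union>(a, b)\<in>C. {a<..<b}))"
      using neg by (simp add: bl)
  qed
qed

text \<open>The local inequality adds up over a disjoint Vitali cover. \<open>W\<close>, the union
  of the closed intervals, carries the inequality; \<open>V\<close>, the union of the open ones, can
  serve as the open set of a further covering.\<close>

lemma Vitali_covering_measure:
  fixes S U :: "real set" and M1 M2 :: "real measure"
  assumes U: "open U" "S \<subseteq> U"
    and fine: "\<And>x d. x \<in> S \<Longrightarrow> 0 < d \<Longrightarrow> \<exists>a b. a < b \<and> a \<le> x \<and> x \<le> b \<and> b - a < d \<and>
        c1 * emeasure M1 {a..b} \<le> c2 * emeasure M2 {a..b}"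
    and M1: "sets M1 = sets borel" and M2: "sets M2 = sets borel"
  obtains V W where "open V" "W \<in> sets borel" "V \<subseteq> W" "W \<subseteq> U" "negligible (S - V)"
    "c1 * emeasure M1 W \<le> c2 * emeasure M2 W"
proof -
  obtain C where C: "countable C" "\<And>a b. (a, b) \<in> C \<Longrightarrow> a < b \<and> 
     c1 * emeasure M1 {a..b} \<le> c2 * emeasure M2 {a..b} \<and> {a..b} \<subseteq> U"
    "disjoint_family_on (\<lambda>(a, b). {a..b}) C" "negligible (S - (\<Union>(a, b)\<in>C. {a<..<b}))"
    by (rule Vitali_covering_intervals[OF U fine]) (assumption | rule that)+
  let ?V = "\<Union>(a, b)\<in>C. {a<..<b}" and ?W = "\<Union>(a, b)\<in>C. {a..b}"
  have "c1 * emeasure M1 ?W = c1 * (\<integral>\<^sup>+ i. emeasure M1 (case i of (a, b) \<Rightarrow> {a..b}) \<partial>count_space C)"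
    by (subst emeasure_UN_countable[OF _ C(1,3)]) (simp_all add: M1 split: prod.split)
  also have "\<dots> = (\<integral>\<^sup>+ i. c1 * emeasure M1 (case i of (a, b) \<Rightarrow> {a..b}) \<partial>count_space C)"
    by (simp add: nn_integral_cmult)
  also have "\<dots> \<le> (\<integral>\<^sup>+ i. c2 * emeasure M2 (case i of (a, b) \<Rightarrow> {a..b}) \<partial>count_space C)"
    using C(2) by (intro nn_integral_mono) auto
  also have "\<dots> = c2 * (\<integral>\<^sup>+ i. emeasure M2 (case i of (a, b) \<Rightarrow> {a..b}) \<partial>count_space C)"
    by (simp add: nn_integral_cmult)
  also have "\<dots> = c2 * emeasure M2 ?W"
    by (subst emeasure_UN_countable[OF _ C(1,3)]) (simp_all add: M2 split: prod.split)
  finally have le: "c1 * emeasure M1 ?W \<le> c2 * emeasure M2 ?W" .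
  have Wb: "?W \<in> sets borel"
    using C(1) by (intro sets.countable_UN') auto
  show ?thesis
  proof (rule that)
    show "open ?V" by (auto intro!: open_UN)
    show "?V \<subseteq> ?W" by (intro UN_mono) auto
    show "?W \<subseteq> U" using C(2) by auto
  qed (use le Wb C(4) in auto)
qed

text \<open>Let \<open>m\<close> be the outer measure of \<open>S\<close>, finite by boundedness.
  \<open>U\<close> can be taken of measure near \<open>m\<close>, while each \<open>W\<close> has
  measure at least \<open>m\<close>. In the limit \<open>q * m \<le> p * m\<close>, so
  \<open>m = 0\<close>.\<close>

lemma negligible_if_outer_measure_shrinks:
  fixes S :: "real set" and p q :: real
  assumes "bounded S" "0 < p" "p < q"
    and step: "\<And>U. open U \<Longrightarrow> S \<subseteq> U \<Longrightarrow>
        \<exists>W\<in>sets borel. negligible (S - W) \<and> ennreal q * emeasure lborel W \<le> ennreal p * emeasure lborel U"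
  shows "negligible S"
proof -
  define m where "m = (INF U\<in>{U. open U \<and> S \<subseteq> U}. emeasure lborel U)"
  obtain k where k: "S \<subseteq> ball 0 k" using \<open>bounded S\<close> bounded_subset_ballD by blast
  have "m \<le> emeasure lborel (ball (0::real) k)"
    unfolding m_def using k by (intro INF_lower) auto
  also have "\<dots> < \<infinity>" by (rule emeasure_lborel_ball_finite)
  finally have mfin: "m < \<infinity>" .
  \<comment> \<open>\<open>W\<close> covers \<open>S\<close> only up to a null set; adding that set
    and enclosing the result in an open set costs at most \<open>e\<close>.\<close>
  have le: "m \<le> emeasure lborel W" if W: "W \<in> sets borel" "negligible (S - W)" for W
  proof (rule ennreal_le_epsilon)
    fix e :: real assume e: "0 < e"
    have nl: "S - W \<in> null_sets lebesgue" using W by (simp add: negligible_iff_null_sets)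
    then have sl: "W \<union> (S - W) \<in> sets lebesgue"
      using W by (intro sets.Un) (auto dest: null_setsD2)
    obtain T where T: "open T" "W \<union> (S - W) \<subseteq> T" "emeasure lebesgue (T - (W \<union> (S - W))) < ennreal e"
      using sets_lebesgue_outer_open[OF sl e] by metis
    have "m \<le> emeasure lborel T" unfolding m_def using T by (intro INF_lower) auto
    also have "\<dots> = emeasure lebesgue T" using T by simp
    also have "\<dots> = emeasure lebesgue ((W \<union> (S - W)) \<union> (T - (W \<union> (S - W))))" using T by (simp add: Un_absorb1)
    also have "\<dots> \<le> emeasure lebesgue (W \<union> (S - W)) + emeasure lebesgue (T - (W \<union> (S - W)))"
      using T sl by (intro emeasure_subadditive) auto
    also have "emeasure lebesgue (W \<union> (S - W)) = emeasure lebesgue W"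
      using W nl by (intro emeasure_Un_null_set) auto
    finally show "m \<le> emeasure lborel W + ennreal e"
      using T(3) W by (simp add: order_trans[OF _ add_left_mono])
  qed
  obtain \<mu> where \<mu>: "0 \<le> \<mu>" "m = ennreal \<mu>" using mfin by (cases m) auto
  have shrink: "q * \<mu> \<le> p * (\<mu> + e)" if "e > 0" for e
  proof -
    have "m < ennreal (\<mu> + e)" using \<mu> that by (simp add: ennreal_less_iff)
    then obtain U where U: "open U" "S \<subseteq> U" "emeasure lborel U < ennreal (\<mu> + e)"
      unfolding m_def INF_less_iff by blast
    obtain W where W: "W \<in> sets borel" "negligible (S - W)"
      "ennreal q * emeasure lborel W \<le> ennreal p * emeasure lborel U"
      using step U by blast
    have "ennreal q * m \<le> ennreal q * emeasure lborel W"
      using le W by (intro mult_left_mono) auto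
    also note W(3)
    also have "ennreal p * emeasure lborel U \<le> ennreal p * ennreal (\<mu> + e)"
      using U by (intro mult_left_mono) auto
    finally show ?thesis
      using assms(2,3) \<mu> that by (simp flip: ennreal_mult ennreal_plus)
  qed
  have "\<mu> = 0"
  proof (rule ccontr)
    assume "\<mu> \<noteq> 0"
    then have "0 < (q - p) * \<mu>" using \<mu> assms by simp
    \<comment> \<open>This \<open>e\<close> makes \<open>p * e\<close> half of the gap
      \<open>(q - p) * \<mu>\<close>.\<close>
    then have "q * \<mu> \<le> p * (\<mu> + (q - p) * \<mu> / (2 * p))"
      using assms(2) by (intro shrink) simp
    also have "\<dots> = p * \<mu> + (q - p) * \<mu> / 2"
      using assms(2) by (simp add: distrib_left)
    finally have "q * \<mu> \<le> p * \<mu> + (q * \<mu> - p * \<mu>) / 2" by (simp only: left_diff_distrib)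
    moreover have "a \<le> b" if "a \<le> b + (a - b) / 2" for a b :: real using that by (simp add: field_simps)
    ultimately have "q * \<mu> \<le> p * \<mu>" by blast
    with \<open>0 < (q - p) * \<mu>\<close> show False by (simp add: left_diff_distrib)
  qed
  then have m0: "m = 0" using \<mu> by simp
  show ?thesis unfolding negligible_outer
  proof (intro allI impI)
    fix e :: real assume "0 < e"
    then have "m < ennreal e" using m0 by simp
    then obtain U where U: "open U" "S \<subseteq> U" "emeasure lborel U < ennreal e"
      unfolding m_def INF_less_iff by blast
    then have "emeasure lborel U < \<infinity>" using order_less_trans by fastforce
    then have "U \<in> lmeasurable" using U by (auto simp: fmeasurable_def)
    moreover have "emeasure lborel U = ennreal (measure lebesgue U)"
      using U(1) emeasure_eq_measure2[OF \<open>U \<in> lmeasurable\<close>] by simp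
    then have "measure lebesgue U < e"
      using U(3) by (simp add: ennreal_less_iff)
    ultimately show "\<exists>T. S \<subseteq> T \<and> T \<in> lmeasurable \<and> measure lebesgue T < e" using U by blast
  qed
qed

text \<open>The Stieltjes measure of \<open>g\<close> is compared with Lebesgue measure twice.
  Intervals of slope below \<open>p\<close> give a \<open>W\<close> inside \<open>U\<close> with
  \<open>\<nu>(W) \<le> p |W|\<close>; intervals of slope above \<open>q\<close> then give a
  \<open>W'\<close> inside \<open>W\<close> with \<open>q |W'| \<le> \<nu>(W')\<close>. Chained,
  \<open>q |W'| \<le> p |U|\<close>, so the outer measure of \<open>S\<close> shrinks.\<close>

lemma negligible_oscillating_quotient:
  fixes g :: "real \<Rightarrow> real" and p q :: real and S :: "real set"
  assumes mono: "mono g" and cont: "continuous_on UNIV g" and pq: "0 < p" "p < q" and "bounded S"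
    and lo: "\<And>x. x \<in> S \<Longrightarrow> \<exists>\<^sub>F y in at x. (g y - g x) / (y - x) < p"
    and hi: "\<And>x. x \<in> S \<Longrightarrow> \<exists>\<^sub>F y in at x. q < (g y - g x) / (y - x)"
  shows "negligible S"
proof (rule negligible_if_outer_measure_shrinks[OF \<open>bounded S\<close> pq])
  let ?\<nu> = "interval_measure g"
  have \<nu>: "emeasure ?\<nu> {a..b} = ennreal (g b - g a)" if "a \<le> b" for a b
    using that mono cont by (intro emeasure_interval_measure_Icc) (auto simp: mono_def)
  have near: "\<exists>a b. a < b \<and> a \<le> x \<and> x \<le> b \<and> b - a < d \<and> R ((g b - g a) / (b - a))"
    if "\<exists>\<^sub>F y in at x. R ((g y - g x) / (y - x))" "0 < d" for x d R
  proof -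
    have "\<exists>\<^sub>F y in at x. R ((g y - g x) / (y - x)) \<and> (y \<noteq> x \<and> dist y x < d)"
      using that by (intro frequently_eventually_frequently) (auto simp: eventually_at)
    then obtain y where y: "R ((g y - g x) / (y - x))" "y \<noteq> x" "dist y x < d"
      using frequently_ex by blast
    show ?thesis
    proof (cases "x < y")
      case True then show ?thesis using y by (intro exI[of _ x] exI[of _ y]) (auto simp: dist_real_def)
    next
      case False
      moreover have "(g y - g x) / (y - x) = (g x - g y) / (x - y)"
        by (metis minus_diff_eq minus_divide_divide)
      ultimately show ?thesis using y by (intro exI[of _ y] exI[of _ x]) (auto simp: dist_real_def)
    qed
  qed
  have lo': "\<exists>a b. a < b \<and> a \<le> x \<and> x \<le> b \<and> b - a < d \<and>
      1 * emeasure ?\<nu> {a..b} \<le> ennreal p * emeasure lborel {a..b}" if "x \<in> S" "0 < d" for x d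
  proof -
    obtain a b where ab: "a < b" "a \<le> x" "x \<le> b" "b - a < d" "(g b - g a) / (b - a) < p"
      using near[OF lo[OF \<open>x \<in> S\<close>] \<open>0 < d\<close>] by blast
    then have "g b - g a \<le> p * (b - a)" by (simp add: divide_less_eq)
    then show ?thesis using ab pq
      by (intro exI[of _ a] exI[of _ b]) (simp add: \<nu> ennreal_leI flip: ennreal_mult)
  qed
  have hi': "\<exists>a b. a < b \<and> a \<le> x \<and> x \<le> b \<and> b - a < d \<and>
      ennreal q * emeasure lborel {a..b} \<le> 1 * emeasure ?\<nu> {a..b}" if "x \<in> S" "0 < d" for x d
  proof -
    obtain a b where ab: "a < b" "a \<le> x" "x \<le> b" "b - a < d" "q < (g b - g a) / (b - a)"
      using near[OF hi[OF \<open>x \<in> S\<close>] \<open>0 < d\<close>] by blast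
    then have "q * (b - a) \<le> g b - g a" by (simp add: less_divide_eq)
    then show ?thesis using ab pq
      by (intro exI[of _ a] exI[of _ b]) (simp add: \<nu> ennreal_leI flip: ennreal_mult)
  qed
  fix U :: "real set" assume U: "open U" "S \<subseteq> U"
  obtain V W where VW: "open V" "W \<in> sets borel" "V \<subseteq> W" "W \<subseteq> U" "negligible (S - V)"
      "1 * emeasure ?\<nu> W \<le> ennreal p * emeasure lborel W"
    by (rule Vitali_covering_measure[OF U lo']) auto
  \<comment> \<open>The second cover lives in the open set \<open>V\<close>, so it treats only
    \<open>S \<inter> V\<close>; the rest of \<open>S\<close> is null by the first cover.\<close>
  obtain V' W' where VW': "open V'" "W' \<in> sets borel" "V' \<subseteq> W'" "W' \<subseteq> V" "negligible (S \<inter> V - V')"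
      "ennreal q * emeasure lborel W' \<le> 1 * emeasure ?\<nu> W'"
    by (rule Vitali_covering_measure[OF VW(1) Int_lower2 hi']) auto
  have "negligible (S - W')"
    by (rule negligible_subset[OF negligible_Un[OF VW(5) VW'(5)]]) (use VW'(3) in auto)
  moreover have "ennreal q * emeasure lborel W' \<le> ennreal p * emeasure lborel U"
  proof -
    have "ennreal q * emeasure lborel W' \<le> emeasure ?\<nu> W'" using VW' by simp
    also have "\<dots> \<le> emeasure ?\<nu> W" using VW VW' by (intro emeasure_mono) auto
    also have "\<dots> \<le> ennreal p * emeasure lborel W" using VW by simp
    also have "\<dots> \<le> ennreal p * emeasure lborel U" using VW U by (intro mult_left_mono emeasure_mono) auto
    finally show ?thesis .
  qed
  ultimately show "\<exists>W\<in>sets borel. negligible (S - W) \<and> ennreal q * emeasure lborel W \<le> ennreal p * emeasure lborel U"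
    using VW' by blast
qed

text \<open>If the lower and upper limits differed, two rationals between them would both be crossed
  frequently; the bound \<open>B\<close> makes the common value finite. Rational levels keep the
  later exceptional family countable.\<close>

lemma tendsto_if_not_oscillating:
  fixes f :: "'a \<Rightarrow> real"
  assumes "F \<noteq> bot" and bd: "\<forall>\<^sub>F x in F. \<bar>f x\<bar> \<le> B"
    and osc: "\<And>p q. p \<in> \<rat> \<Longrightarrow> q \<in> \<rat> \<Longrightarrow> p < q \<Longrightarrow> \<exists>\<^sub>F x in F. f x < p \<Longrightarrow> \<exists>\<^sub>F x in F. q < f x \<Longrightarrow> False"
  shows "\<exists>l. (f \<longlongrightarrow> l) F"
proof -
  let ?f = "\<lambda>x. ereal (f x)"
  have le: "Liminf F ?f \<le> Limsup F ?f" using Liminf_le_Limsup[OF assms(1)] .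
  have eq: "Liminf F ?f = Limsup F ?f"
  proof (rule ccontr)
    assume "Liminf F ?f \<noteq> Limsup F ?f"
    with le have lt: "Liminf F ?f < Limsup F ?f" by simp
    obtain p where p: "Liminf F ?f < ereal (real_of_rat p)" "ereal (real_of_rat p) < Limsup F ?f"
      using ereal_dense3[OF lt] by blast
    obtain q where q: "real_of_rat p < real_of_rat q" "ereal (real_of_rat q) < Limsup F ?f"
      using ereal_dense3[OF p(2)] by auto
    have "\<exists>\<^sub>F x in F. f x < real_of_rat p"
    proof (rule ccontr)
      assume "\<not> ?thesis"
      then have "\<forall>\<^sub>F x in F. ereal (real_of_rat p) \<le> ?f x" by (simp add: not_frequently not_less)
      then have "ereal (real_of_rat p) \<le> Liminf F ?f" by (rule Liminf_bounded)
      with p(1) show False by (simp add: leD)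
    qed
    moreover have "\<exists>\<^sub>F x in F. real_of_rat q < f x"
    proof (rule ccontr)
      assume "\<not> ?thesis"
      then have "\<forall>\<^sub>F x in F. ?f x \<le> ereal (real_of_rat q)" by (simp add: not_frequently not_less)
      then have "Limsup F ?f \<le> ereal (real_of_rat q)" by (rule Limsup_bounded)
      with q(2) show False by (simp add: leD)
    qed
    ultimately show False using osc[of "real_of_rat p" "real_of_rat q"] q(1) by auto
  qed
  then have lim: "(?f \<longlongrightarrow> Limsup F ?f) F" by (intro Liminf_eq_Limsup assms) auto
  have "Limsup F ?f \<le> ereal B"
    using bd by (intro Limsup_bounded) (auto elim: eventually_mono)
  moreover have "ereal (- B) \<le> Liminf F ?f"
    using bd by (intro Liminf_bounded) (auto elim: eventually_mono)
  ultimately obtain l where "Limsup F ?f = ereal l"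
    using eq by (cases "Limsup F ?f") auto
  with lim show ?thesis by auto
qed

text \<open>Rademacher's theorem on the line. Adding \<open>(L + 1) * x\<close> makes the function
  increasing with all difference quotients in \<open>[1, 2 L + 1]\<close>; where it is not
  differentiable, the quotient oscillates across a pair of rationals.\<close>

theorem lipschitz_negligible_not_differentiable:
  fixes f :: "real \<Rightarrow> real"
  assumes "L-lipschitz_on UNIV f"
  shows "negligible {x. \<not> f differentiable (at x)}"
proof -
  define g where "g x = f x + (L + 1) * x" for x
  have L: "0 \<le> L" using assms by (rule lipschitz_on_nonneg)
  have f_lip: "\<bar>f y - f x\<bar> \<le> L * \<bar>y - x\<bar>" for x y
    using lipschitz_onD[OF assms] by (simp add: dist_real_def)
  have "mono g"
  proof
    fix x y :: real assume "x \<le> y"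
    then have "f x - f y \<le> L * (y - x)" using f_lip[of y x] by simp
    with \<open>x \<le> y\<close> show "g x \<le> g y" by (simp add: g_def algebra_simps)
  qed
  have "continuous_on UNIV g"
    unfolding g_def using lipschitz_on_continuous_on[OF assms] by (intro continuous_intros)
  have quot: "(g y - g x) / (y - x) = (f y - f x) / (y - x) + (L + 1)" if "y \<noteq> x" for x y
    using that by (simp add: g_def field_simps)
  have f_quot: "\<bar>(f y - f x) / (y - x)\<bar> \<le> L" if "y \<noteq> x" for x y
    using f_lip[of y x] that by (simp add: divide_le_eq)
  have g_quot: "1 \<le> (g y - g x) / (y - x)" "(g y - g x) / (y - x) \<le> 2 * L + 1" if "y \<noteq> x" for x y
    using f_quot[OF that] quot[OF that] by linarith+
  define S where "S p q = {x. (\<exists>\<^sub>F y in at x. (g y - g x) / (y - x) < p) \<and>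
      (\<exists>\<^sub>F y in at x. q < (g y - g x) / (y - x))}" for p q
  \<comment> \<open>Quotients are at least 1, so a level \<open>p\<close> that they undercut is
    automatically positive.\<close>
  have p0: "0 < p" if "x \<in> S p q" for x p q
  proof (rule ccontr)
    assume "\<not> 0 < p"
    then have "\<forall>\<^sub>F y in at x. \<not> (g y - g x) / (y - x) < p"
      unfolding eventually_at using g_quot(1) by (force intro!: exI[of _ 1])
    then show False using that by (simp add: S_def frequently_def)
  qed
  have neg: "negligible (S p q \<inter> cball 0 n)" if "p < q" for p q n :: real
  proof (cases "S p q = {}")
    case False
    then have "0 < p" using p0 by blast
    then show ?thesis
      using that \<open>mono g\<close> \<open>continuous_on UNIV g\<close>
      by (intro negligible_oscillating_quotient[of g p q]) (auto simp: S_def)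
  qed auto
  have sub: "{x. \<not> f differentiable (at x)} \<subseteq> (\<Union>(p, q)\<in>{(p, q). p \<in> \<rat> \<and> q \<in> \<rat> \<and> p < q}. \<Union>n::nat. S p q \<inter> cball 0 (real n))"
  proof safe
    fix x assume nd: "\<not> f differentiable (at x)"
    have "\<exists>p q. p \<in> \<rat> \<and> q \<in> \<rat> \<and> p < q \<and> x \<in> S p q"
    proof (rule ccontr)
      assume no: "\<not> ?thesis"
      have osc: False if "p \<in> \<rat>" "q \<in> \<rat>" "p < q" "\<exists>\<^sub>F y in at x. (g y - g x) / (y - x) < p"
        "\<exists>\<^sub>F y in at x. q < (g y - g x) / (y - x)" for p q
      proof -
        have "x \<in> S p q" using that(4,5) by (simp add: S_def)
        with no that(1-3) show False by blast
      qed
      have "\<forall>\<^sub>F y in at x. y \<noteq> x" by (simp add: eventually_neq_at_within)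
      then have "\<forall>\<^sub>F y in at x. \<bar>(g y - g x) / (y - x)\<bar> \<le> 2 * L + 1"
      proof eventually_elim
        case (elim y)
        show ?case using g_quot[OF elim] by linarith
      qed
      then have "\<exists>l. ((\<lambda>y. (g y - g x) / (y - x)) \<longlongrightarrow> l) (at x)"
        by (rule tendsto_if_not_oscillating[OF at_neq_bot]) (rule osc)
      then obtain l where "((\<lambda>y. (g y - g x) / (y - x)) \<longlongrightarrow> l) (at x)" ..
      then have "(g has_field_derivative l) (at x)" by (simp add: has_field_derivative_iff)
      then have "((\<lambda>x. g x - (L + 1) * x) has_field_derivative l - (L + 1) * 1) (at x)"
        by (intro DERIV_diff DERIV_cmult DERIV_ident)
      then have "f differentiable (at x)"
        by (auto simp: g_def real_differentiable_def)
      with nd show False by simp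
    qed
    then obtain p q where "p \<in> \<rat>" "q \<in> \<rat>" "p < q" "x \<in> S p q" by blast
    moreover obtain n :: nat where "x \<in> cball 0 (real n)"
      using real_arch_simple[of "\<bar>x\<bar>"] by auto
    ultimately show "x \<in> (\<Union>(p, q)\<in>{(p, q). p \<in> \<rat> \<and> q \<in> \<rat> \<and> p < q}. \<Union>n::nat. S p q \<inter> cball 0 (real n))"
      by auto
  qed
  have "countable {(p, q). p \<in> \<rat> \<and> q \<in> \<rat> \<and> p < (q::real)}"
    by (rule countable_subset[of _ "\<rat> \<times> \<rat>"]) (auto intro: countable_rat)
  moreover have "negligible (\<Union>n::nat. S p q \<inter> cball 0 (real n))" if "p < q" for p q
    using neg[OF that] by (intro negligible_countable_Union) auto
  ultimately have "negligible (\<Union>(p, q)\<in>{(p, q). p \<in> \<rat> \<and> q \<in> \<rat> \<and> p < q}. \<Union>n::nat. S p q \<inter> cball 0 (real n))"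
    by (intro negligible_countable_Union) (auto simp del: UN_simps Int_UN_distrib)
  then show ?thesis using sub by (rule negligible_subset)
qed

section \<open>Null sets of one-dimensional Hausdorff measure\<close>

lemma hausdorff1_eq_0I:
  fixes A :: "(real \<times> real) set"
  assumes "\<And>e::real. 0 < e \<Longrightarrow> \<exists>(I :: 'i set) C. countable I \<and> A \<subseteq> (\<Union>i\<in>I. C i) \<and> (\<forall>i\<in>I. bounded (C i)) \<and>
      (\<integral>\<^sup>+i. ennreal (diameter (C i)) \<partial>count_space I) \<le> ennreal e"
  shows "hausdorff1 A = 0"
proof -
  have "H1_delta d A \<le> ennreal e" if "0 < d" "0 < e" for d e :: real
  proof -
    have "0 < min d e" using that by simp
    then obtain I :: "'i set" and C where C: "countable I" "A \<subseteq> (\<Union>i\<in>I. C i)" "\<forall>i\<in>I. bounded (C i)"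
      and le: "(\<integral>\<^sup>+i. ennreal (diameter (C i)) \<partial>count_space I) \<le> ennreal (min d e)"
      using assms[of "min d e"] by metis
    define J where "J = to_nat_on I ` I"
    \<comment> \<open>The cover is renumbered by naturals; the remaining indices get the empty set,
      of diameter 0.\<close>
    define C' where "C' n = (if n \<in> J then C (from_nat_into I n) else {})" for n
    have "(\<Sum>n. ennreal (diameter (C' n))) = (\<integral>\<^sup>+n. ennreal (diameter (C' n)) \<partial>count_space UNIV)"
      by (rule nn_integral_count_space_nat[symmetric])
    also have "\<dots> = (\<integral>\<^sup>+n. ennreal (diameter (C' n)) \<partial>count_space J)"
      by (rule nn_integral_count_space_eq) (auto simp: C'_def)
    also have "\<dots> = (\<integral>\<^sup>+i. ennreal (diameter (C' (to_nat_on I i))) \<partial>count_space I)"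
      unfolding J_def by (rule nn_integral_bij_count_space[symmetric])
         (use C(1) inj_on_to_nat_on in \<open>auto simp: bij_betw_def\<close>)
    also have "\<dots> = (\<integral>\<^sup>+i. ennreal (diameter (C i)) \<partial>count_space I)"
      using C(1) by (intro nn_integral_cong) (auto simp: C'_def J_def)
    finally have sum: "(\<Sum>n. ennreal (diameter (C' n))) \<le> ennreal (min d e)" using le by simp
    have "diameter (C' n) \<le> d" for n
    proof -
      have "ennreal (diameter (C' n)) = (\<Sum>k\<in>{n}. ennreal (diameter (C' k)))" by simp
      also have "\<dots> \<le> (\<Sum>k. ennreal (diameter (C' k)))" by (rule sum_le_suminf) auto
      finally have "ennreal (diameter (C' n)) \<le> ennreal (min d e)" using sum by (rule order_trans)
      then show ?thesis using that by (auto simp: ennreal_le_iff2)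
    qed
    moreover have "A \<subseteq> (\<Union>n. C' n)"
    proof
      fix x assume "x \<in> A"
      then obtain i where i: "i \<in> I" "x \<in> C i" using C(2) by blast
      then have "x \<in> C' (to_nat_on I i)" using C(1) by (auto simp: C'_def J_def)
      then show "x \<in> (\<Union>n. C' n)" by blast
    qed
    moreover have "bounded (C' n)" for n
      using C by (auto simp: C'_def J_def)
    ultimately have "H1_delta d A \<le> (\<Sum>n. ennreal (diameter (C' n)))"
      unfolding H1_delta_def by (intro INF_lower) auto
    also note sum
    also have "ennreal (min d e) \<le> ennreal e" by (intro ennreal_leI) simp
    finally show ?thesis .
  qed
  note small = this
  have "H1_delta d A \<le> 0" if "0 < d" for d
    by (rule ennreal_le_epsilon) (simp add: small[OF that])
  then have "hausdorff1 A \<le> 0" unfolding hausdorff1_def by (intro SUP_least) simp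
  then show ?thesis by simp
qed

lemma hausdorff1_eq_0D:
  assumes "hausdorff1 A = 0" "0 < e"
  obtains C :: "nat \<Rightarrow> (real \<times> real) set" where "A \<subseteq> (\<Union>n. C n)" "\<And>n. bounded (C n)"
    "(\<Sum>n. ennreal (diameter (C n))) < ennreal e"
proof -
  \<comment> \<open>The scale 1 is an arbitrary choice: every \<open>H1_delta d A\<close> with
    \<open>d > 0\<close> lies below the supremum.\<close>
  have "H1_delta 1 A \<le> hausdorff1 A" unfolding hausdorff1_def by (rule SUP_upper) simp
  then have "H1_delta 1 A < ennreal e" using assms by simp
  then show ?thesis unfolding H1_delta_def INF_less_iff using that by auto
qed

lemma hausdorff1_null_UN_nat:
  assumes "\<And>i::nat. hausdorff1 (A i) = 0"
  shows "hausdorff1 (\<Union>i. A i) = 0"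
proof (rule hausdorff1_eq_0I)
  fix e :: real assume e: "0 < e"
  have "\<exists>C :: nat \<Rightarrow> (real \<times> real) set. A i \<subseteq> (\<Union>n. C n) \<and> (\<forall>n. bounded (C n)) \<and>
      (\<Sum>n. ennreal (diameter (C n))) \<le> ennreal (e * (1/2) ^ Suc i)" for i
  proof -
    have "0 < e * (1/2) ^ Suc i" using e by simp
    from hausdorff1_eq_0D[OF assms this, of i] show ?thesis by (metis less_imp_le)
  qed
  then obtain C :: "nat \<Rightarrow> nat \<Rightarrow> (real \<times> real) set" where C: "\<And>i. A i \<subseteq> (\<Union>n. C i n)" "\<And>i n. bounded (C i n)"
      "\<And>i. (\<Sum>n. ennreal (diameter (C i n))) \<le> ennreal (e * (1/2) ^ Suc i)"
    by metis
  have "(\<integral>\<^sup>+x. ennreal (diameter (case x of (i, n) \<Rightarrow> C i n)) \<partial>count_space UNIV)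
      = (\<integral>\<^sup>+i. \<integral>\<^sup>+n. ennreal (diameter (C i n)) \<partial>count_space UNIV \<partial>count_space UNIV)"
    by (subst nn_integral_fst_count_space[symmetric]) simp
  also have "\<dots> = (\<Sum>i. \<Sum>n. ennreal (diameter (C i n)))"
    by (simp add: nn_integral_count_space_nat)
  also have "\<dots> \<le> (\<Sum>i. ennreal (e * (1/2) ^ Suc i))"
    by (intro suminf_le C) auto
  also have "\<dots> = ennreal e"
  proof (rule suminf_ennreal_eq)
    show "(\<lambda>i. e * (1/2) ^ Suc i) sums e"
      using sums_mult[OF power_half_series, of e] by simp
  qed (use e in auto)
  finally have "(\<integral>\<^sup>+x. ennreal (diameter (case x of (i, n) \<Rightarrow> C i n)) \<partial>count_space UNIV) \<le> ennreal e" .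
  moreover have "(\<Union>i. A i) \<subseteq> (\<Union>x\<in>UNIV. case x of (i, n) \<Rightarrow> C i n)"
    using C(1) by fastforce
  ultimately show "\<exists>(I :: (nat \<times> nat) set) C. countable I \<and> (\<Union>i. A i) \<subseteq> (\<Union>i\<in>I. C i) \<and> (\<forall>i\<in>I. bounded (C i)) \<and>
      (\<integral>\<^sup>+i. ennreal (diameter (C i)) \<partial>count_space I) \<le> ennreal e"
    using C(2) by (intro exI[of _ UNIV] exI[of _ "\<lambda>(i, n). C i n"]) auto
qed

lemma hausdorff1_null_subset:
  assumes "hausdorff1 B = 0" "A \<subseteq> B"
  shows "hausdorff1 A = 0"
proof (rule hausdorff1_eq_0I)
  fix e :: real assume "0 < e"
  then obtain C :: "nat \<Rightarrow> (real \<times> real) set" where "B \<subseteq> (\<Union>n. C n)" "\<And>n. bounded (C n)"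
    "(\<Sum>n. ennreal (diameter (C n))) < ennreal e"
    using hausdorff1_eq_0D[OF assms(1)] by metis
  with assms(2) show "\<exists>(I :: nat set) C. countable I \<and> A \<subseteq> (\<Union>i\<in>I. C i) \<and> (\<forall>i\<in>I. bounded (C i)) \<and>
      (\<integral>\<^sup>+i. ennreal (diameter (C i)) \<partial>count_space I) \<le> ennreal e"
    by (intro exI[of _ UNIV] exI[of _ C]) (auto simp: nn_integral_count_space_nat)
qed

lemma hausdorff1_empty: "hausdorff1 {} = 0"
  by (rule hausdorff1_eq_0I) (rule exI[of _ "{} :: nat set"], simp add: nn_integral_empty)

lemma hausdorff1_null_UN:
  assumes "countable I" "\<And>i. i \<in> I \<Longrightarrow> hausdorff1 (A i) = 0"
  shows "hausdorff1 (\<Union>i\<in>I. A i) = 0"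
proof (cases "I = {}")
  case False
  have "(\<Union>i\<in>I. A i) = (\<Union>n. A (from_nat_into I n))"
    using range_from_nat_into[OF False assms(1)] by (metis image_image)
  then show ?thesis
    using hausdorff1_null_UN_nat[of "\<lambda>n. A (from_nat_into I n)"] assms(2) from_nat_into[OF False] by simp
qed (simp add: hausdorff1_empty)

lemma hausdorff1_null_Un:
  assumes "hausdorff1 A = 0" "hausdorff1 B = 0"
  shows "hausdorff1 (A \<union> B) = 0"
proof -
  have "hausdorff1 (\<Union>X\<in>{A, B}. X) = 0"
    by (rule hausdorff1_null_UN) (use assms in auto)
  then show ?thesis by simp
qed

text \<open>\<open>N\<close> is covered by nonoverlapping intervals of total length at most
  \<open>e / (L + 1)\<close>, and the image of each piece has diameter at most \<open>L\<close>
  times the length. Using \<open>L + 1\<close> keeps the divisor positive when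
  \<open>L = 0\<close>.\<close>

lemma hausdorff1_lipschitz_image_null_bounded:
  fixes h :: "real \<Rightarrow> real \<times> real"
  assumes "negligible N" "bounded N" "L-lipschitz_on N h"
  shows "hausdorff1 (h ` N) = 0"
proof (rule hausdorff1_eq_0I)
  fix e :: real assume e: "0 < e"
  have L: "0 \<le> L" using assms(3) by (rule lipschitz_on_nonneg)
  obtain k where k: "N \<subseteq> cbox (-k) k" using bounded_subset_cbox_symmetric[OF assms(2)] by blast
  have Nm: "N \<in> lmeasurable" "measure lebesgue N = 0"
    using assms(1) by (auto simp: negligible_iff_measure)
  have "0 < e / (L + 1)" using e L by simp
  from measurable_outer_intervals_bounded[OF Nm(1) k this]
  obtain D where D: "countable D" "\<And>K. K \<in> D \<Longrightarrow> K \<subseteq> cbox (-k) k \<and> K \<noteq> {} \<and> (\<exists>c d. K = cbox c d)"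
        "pairwise (\<lambda>A B. interior A \<inter> interior B = {}) D" "N \<subseteq> \<Union>D" "\<Union>D \<in> lmeasurable"
        "measure lebesgue (\<Union>D) \<le> measure lebesgue N + e / (L + 1)"
    by metis
  \<comment> \<open>Length is expressed through the interior because only the interiors of the
    intervals in \<open>D\<close> are disjoint.\<close>
  have diam: "bounded (h ` (N \<inter> K)) \<and> ennreal (diameter (h ` (N \<inter> K))) \<le> ennreal (L + 1) * emeasure lebesgue (interior K)"
    if "K \<in> D" for K
  proof -
    obtain c d where K: "K = {c..d}" "c \<le> d" using D(2)[OF \<open>K \<in> D\<close>] by (metis atLeastatMost_empty_iff2 cbox_interval)
    have lip: "norm (x - y) \<le> L * (d - c)" if "x \<in> h ` (N \<inter> K)" "y \<in> h ` (N \<inter> K)" for x y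
    proof -
      obtain s t where st: "x = h s" "y = h t" "s \<in> N" "t \<in> N" "s \<in> K" "t \<in> K" using \<open>x \<in> _\<close> \<open>y \<in> _\<close> by blast
      have "norm (x - y) \<le> L * norm (s - t)" using lipschitz_on_normD[OF assms(3) st(3,4)] st by simp
      also have "\<dots> \<le> L * (d - c)" using st(5,6) K L by (intro mult_left_mono) auto
      finally show ?thesis .
    qed
    have Ld: "0 \<le> L * (d - c)" using L K by simp
    have "diameter (h ` (N \<inter> K)) \<le> L * (d - c)"
      by (rule diameter_le) (use lip Ld in auto)
    also have "\<dots> \<le> (L + 1) * (d - c)" using K by (intro mult_right_mono) auto
    finally have "ennreal (diameter (h ` (N \<inter> K))) \<le> ennreal ((L + 1) * (d - c))" by (rule ennreal_leI)
    also have "\<dots> = ennreal (L + 1) * emeasure lebesgue (interior K)"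
      using K L by (simp add: ennreal_mult)
    finally have "ennreal (diameter (h ` (N \<inter> K))) \<le> ennreal (L + 1) * emeasure lebesgue (interior K)" .
    moreover have "bounded (h ` (N \<inter> K))"
      using lip unfolding bounded_two_points dist_norm by blast
    ultimately show ?thesis by blast
  qed
  have "(\<integral>\<^sup>+K. ennreal (diameter (h ` (N \<inter> K))) \<partial>count_space D)
      \<le> (\<integral>\<^sup>+K. ennreal (L + 1) * emeasure lebesgue (interior K) \<partial>count_space D)"
    using diam by (intro nn_integral_mono) simp
  also have "\<dots> = ennreal (L + 1) * (\<integral>\<^sup>+K. emeasure lebesgue (interior K) \<partial>count_space D)"
    by (simp add: nn_integral_cmult)
  also have "(\<integral>\<^sup>+K. emeasure lebesgue (interior K) \<partial>count_space D) = emeasure lebesgue (\<Union>K\<in>D. interior K)"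
    using D(1,3) by (intro emeasure_UN_countable[symmetric]) (auto simp: disjoint_family_on_def pairwise_def)
  also have "\<dots> \<le> emeasure lebesgue (\<Union>D)"
    using D(5) interior_subset by (intro emeasure_mono) (auto simp: fmeasurable_def)
  also have "\<dots> \<le> ennreal (e / (L + 1))"
    using D(6) Nm(2) unfolding emeasure_eq_measure2[OF D(5)] by (intro ennreal_leI) simp
  also have "ennreal (L + 1) * ennreal (e / (L + 1)) = ennreal e"
    using L e by (subst ennreal_mult[symmetric]) auto
  finally have "(\<integral>\<^sup>+K. ennreal (diameter (h ` (N \<inter> K))) \<partial>count_space D) \<le> ennreal e"
    by (simp add: mult_left_mono)
  moreover have "h ` N \<subseteq> (\<Union>K\<in>D. h ` (N \<inter> K))" using D(4) by blast
  ultimately show "\<exists>(I :: real set set) C. countable I \<and> h ` N \<subseteq> (\<Union>i\<in>I. C i) \<and> (\<forall>i\<in>I. bounded (C i)) \<and>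
      (\<integral>\<^sup>+i. ennreal (diameter (C i)) \<partial>count_space I) \<le> ennreal e"
    using D(1) diam by (intro exI[of _ D] exI[of _ "\<lambda>K. h ` (N \<inter> K)"]) simp
qed

lemma hausdorff1_lipschitz_image_null:
  fixes h :: "real \<Rightarrow> real \<times> real"
  assumes "negligible N" "L-lipschitz_on N h"
  shows "hausdorff1 (h ` N) = 0"
proof -
  have "hausdorff1 (h ` (N \<inter> cball 0 (real n))) = 0" for n
  proof (rule hausdorff1_lipschitz_image_null_bounded)
    show "negligible (N \<inter> cball 0 (real n))" using assms(1) by (rule negligible_subset) blast
    show "L-lipschitz_on (N \<inter> cball 0 (real n)) h" using assms(2) by (rule lipschitz_on_subset) blast
  qed auto
  then have "hausdorff1 (\<Union>n. h ` (N \<inter> cball 0 (real n))) = 0" by (rule hausdorff1_null_UN_nat)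
  moreover have "h ` N \<subseteq> (\<Union>n. h ` (N \<inter> cball 0 (real n)))"
    using real_arch_simple by force
  ultimately show ?thesis by (rule hausdorff1_null_subset)
qed

section \<open>The contingent of a set\<close>

text \<open>The Bouligand tangent cone. One \<open>e\<close> bounds both the scale \<open>s\<close>
  and the error relative to \<open>s\<close>, so a vector outside it comes with a single radius
  describing a cone free of points of \<open>G\<close>. Since \<open>Q = P\<close> is allowed, 0
  belongs to the contingent at each point of \<open>G\<close>.\<close>

definition contingent :: "'a::real_normed_vector set \<Rightarrow> 'a \<Rightarrow> 'a set" where
  "contingent G P = {v. \<forall>e>0. \<exists>Q\<in>G. \<exists>s. 0 < s \<and> s < e \<and> norm (Q - P - s *\<^sub>R v) < e * s}"

lemma contingentD:
  assumes "v \<in> contingent G P" "0 < e"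
  obtains Q s where "Q \<in> G" "0 < s" "s < e" "norm (Q - P - s *\<^sub>R v) < e * s"
proof -
  have "\<exists>Q\<in>G. \<exists>s. 0 < s \<and> s < e \<and> norm (Q - P - s *\<^sub>R v) < e * s"
    using assms unfolding contingent_def by simp
  then show ?thesis using that by blast
qed

lemma zero_in_contingent: "P \<in> G \<Longrightarrow> 0 \<in> contingent G P"
  unfolding contingent_def
proof (intro CollectI allI impI)
  fix e :: real assume "P \<in> G" "0 < e"
  then show "\<exists>Q\<in>G. \<exists>s. 0 < s \<and> s < e \<and> norm (Q - P - s *\<^sub>R 0) < e * s"
    by (intro bexI[of _ P] exI[of _ "e / 2"]) auto
qed

lemma contingent_scaleR:
  assumes "v \<in> contingent G P" "0 < k"
  shows "k *\<^sub>R v \<in> contingent G P"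
  unfolding contingent_def
proof (intro CollectI allI impI)
  fix e :: real assume e: "0 < e"
  then have "0 < min (k * e) (e / k)" using assms(2) by simp
  then obtain Q s where Qs: "Q \<in> G" "0 < s" "s < min (k * e) (e / k)"
      "norm (Q - P - s *\<^sub>R v) < min (k * e) (e / k) * s"
    using contingentD[OF assms(1)] by metis
  have "norm (Q - P - (s / k) *\<^sub>R k *\<^sub>R v) < min (k * e) (e / k) * s" using Qs(4) assms(2) by simp
  also have "\<dots> \<le> e / k * s" using Qs(2) by (intro mult_right_mono) auto
  finally have "norm (Q - P - (s / k) *\<^sub>R k *\<^sub>R v) < e * (s / k)" by simp
  moreover have "0 < s / k" "s / k < e" using Qs assms(2) by (auto simp: divide_less_eq mult.commute)
  ultimately show "\<exists>Q\<in>G. \<exists>s. 0 < s \<and> s < e \<and> norm (Q - P - s *\<^sub>R k *\<^sub>R v) < e * s"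
    using Qs(1) by blast
qed

lemma closed_contingent: "closed (contingent G P)"
proof -
  have "v \<in> contingent G P" if v: "v \<in> closure (contingent G P)" for v
    unfolding contingent_def
  proof (intro CollectI allI impI)
    fix e :: real assume e: "0 < e"
    obtain w where w: "w \<in> contingent G P" "dist w v < e / 2" using v half_gt_zero[OF e] unfolding closure_approachable by blast
    obtain Q s where Qs: "Q \<in> G" "0 < s" "s < e / 2" "norm (Q - P - s *\<^sub>R w) < e / 2 * s"
      using contingentD[OF w(1) half_gt_zero[OF e]] .
    have "Q - P - s *\<^sub>R v = (Q - P - s *\<^sub>R w) + s *\<^sub>R (w - v)" by (simp add: algebra_simps)
    then have "norm (Q - P - s *\<^sub>R v) \<le> norm (Q - P - s *\<^sub>R w) + norm (s *\<^sub>R (w - v))"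
      using norm_triangle_ineq by metis
    also have "norm (s *\<^sub>R (w - v)) \<le> s * (e / 2)"
      using w(2) Qs(2) by (simp add: dist_norm)
    finally have "norm (Q - P - s *\<^sub>R v) < e * s" using Qs(4) by (simp add: field_simps)
    moreover have "s < e" using Qs(3) e by linarith
    ultimately show "\<exists>Q\<in>G. \<exists>s. 0 < s \<and> s < e \<and> norm (Q - P - s *\<^sub>R v) < e * s"
      using Qs by blast
  qed
  then show ?thesis by (simp add: subsetI flip: closure_subset_eq)
qed

lemma contingent_mono:
  assumes "G \<subseteq> H"
  shows "contingent G P \<subseteq> contingent H P"
proof
  fix v assume v: "v \<in> contingent G P"
  show "v \<in> contingent H P"
    unfolding contingent_def
  proof (intro CollectI allI impI)
    fix e :: real assume "0 < e"
    then obtain Q s where Qs: "Q \<in> G" "0 < s" "s < e" "norm (Q - P - s *\<^sub>R v) < e * s"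
      by (rule contingentD[OF v])
    then show "\<exists>Q\<in>H. \<exists>s. 0 < s \<and> s < e \<and> norm (Q - P - s *\<^sub>R v) < e * s"
      using subsetD[OF assms Qs(1)] by blast
  qed
qed

lemma contingent_Un: "contingent (G \<union> H) P = contingent G P \<union> contingent H P"
proof
  show "contingent (G \<union> H) P \<subseteq> contingent G P \<union> contingent H P"
  proof (rule subsetI, rule ccontr)
    fix v assume v: "v \<in> contingent (G \<union> H) P" "v \<notin> contingent G P \<union> contingent H P"
    then obtain d e where d: "0 < d" "\<And>Q s. Q \<in> G \<Longrightarrow> 0 < s \<Longrightarrow> s < d \<Longrightarrow> \<not> norm (Q - P - s *\<^sub>R v) < d * s"
      and e: "0 < e" "\<And>Q s. Q \<in> H \<Longrightarrow> 0 < s \<Longrightarrow> s < e \<Longrightarrow> \<not> norm (Q - P - s *\<^sub>R v) < e * s"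
      unfolding contingent_def by blast
    have "0 < min d e" using d e by simp
    then obtain Q s where Qs: "Q \<in> G \<union> H" "0 < s" "s < min d e" "norm (Q - P - s *\<^sub>R v) < min d e * s"
      using contingentD[OF v(1)] by metis
    have "min d e * s \<le> d * s" "min d e * s \<le> e * s" using Qs(2) by (auto intro!: mult_right_mono)
    with d(2)[of Q s] e(2)[of Q s] Qs show False by auto
  qed
qed (simp add: contingent_mono)

lemma contingent_sgn_limit:
  fixes X :: "nat \<Rightarrow> 'a::real_normed_vector"
  assumes "\<And>n. X n \<in> G" "\<And>n. X n \<noteq> P" "X \<longlonglongrightarrow> P" "(\<lambda>n. sgn (X n - P)) \<longlonglongrightarrow> w"
  shows "w \<in> contingent G P"
  unfolding contingent_def
proof (intro CollectI allI impI)
  fix e :: real assume e: "0 < e"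
  have "\<forall>\<^sub>F n in sequentially. dist (X n) P < e \<and> dist (sgn (X n - P)) w < e"
    using tendstoD[OF assms(3) e] tendstoD[OF assms(4) e] by (rule eventually_conj)
  then obtain n where n: "dist (X n) P < e" "dist (sgn (X n - P)) w < e"
    using eventually_happens'[OF sequentially_bot] by blast
  \<comment> \<open>With the distance to \<open>P\<close> as scale, the relative error is exactly
    the distance between the unit direction and \<open>w\<close>.\<close>
  define s where "s = norm (X n - P)"
  have s: "0 < s" "s < e" using assms(2)[of n] n(1) by (auto simp: s_def dist_norm)
  have "X n - P - s *\<^sub>R w = s *\<^sub>R (sgn (X n - P) - w)"
    using s by (simp add: s_def sgn_div_norm algebra_simps)
  then have "norm (X n - P - s *\<^sub>R w) = s * dist (sgn (X n - P)) w"
    using s by (simp add: dist_norm)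
  also have "\<dots> < e * s" using n(2) s by simp
  finally show "\<exists>Q\<in>G. \<exists>s. 0 < s \<and> s < e \<and> norm (Q - P - s *\<^sub>R w) < e * s"
    using s assms(1) by blast
qed

text \<open>Compactness of the unit sphere supplies the convergent directions.\<close>

lemma contingent_subsequence:
  fixes X :: "nat \<Rightarrow> 'a::euclidean_space"
  assumes "\<And>n. X n \<in> G" "\<And>n. X n \<noteq> P" "X \<longlonglongrightarrow> P"
  obtains w r where "w \<in> contingent G P" "norm w = 1" "strict_mono (r :: nat \<Rightarrow> nat)"
    "(\<lambda>n. sgn (X (r n) - P)) \<longlonglongrightarrow> w"
proof -
  have "\<forall>n. sgn (X n - P) \<in> sphere 0 1" using assms(2) by (simp add: norm_sgn)
  then have "\<exists>w\<in>sphere 0 1. \<exists>r. strict_mono r \<and> ((\<lambda>n. sgn (X n - P)) \<circ> r) \<longlonglongrightarrow> w"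
    by (rule compact_sphere[unfolded compact_def, THEN spec, THEN mp])
  then obtain w r where wr: "w \<in> sphere 0 1" "strict_mono r" "((\<lambda>n. sgn (X n - P)) \<circ> r) \<longlonglongrightarrow> w"
    by blast
  have lim: "(\<lambda>n. sgn (X (r n) - P)) \<longlonglongrightarrow> w" using wr(3) by (simp add: o_def)
  have "(\<lambda>n. X (r n)) \<longlonglongrightarrow> P" using LIMSEQ_subseq_LIMSEQ[OF assms(3) wr(2)] by (simp add: o_def)
  then have "w \<in> contingent G P"
    by (rule contingent_sgn_limit[of "\<lambda>n. X (r n)", OF assms(1,2) _ lim])
  moreover have "norm w = 1" using wr(1) by simp
  ultimately show ?thesis using wr(2) lim by (rule that)
qed

lemma contingent_singleton: "contingent {P} P \<subseteq> {0}"
proof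
  fix v assume v: "v \<in> contingent {P} P"
  have "norm v \<le> e" if "0 < e" for e
  proof -
    obtain Q s where "Q \<in> {P}" "0 < s" "s < e" "norm (Q - P - s *\<^sub>R v) < e * s"
      by (rule contingentD[OF v \<open>0 < e\<close>])
    then show ?thesis by simp
  qed
  then have "norm v \<le> 0" by (rule field_le_epsilon[of _ 0, simplified])
  then show "v \<in> {0}" by simp
qed

section \<open>Inequalities and limits expressed by the contingent\<close>

lemma contingent_half_space:
  assumes "bounded_linear \<phi>" "\<And>Q. Q \<in> G \<Longrightarrow> \<phi> (Q - P) \<le> (0::real)" "v \<in> contingent G P"
  shows "\<phi> v \<le> 0"
proof (rule ccontr)
  interpret bounded_linear \<phi> by fact
  assume "\<not> \<phi> v \<le> 0"
  obtain K where K: "0 < K" "\<And>x. norm (\<phi> x) \<le> norm x * K" using pos_bounded by blast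
  \<comment> \<open>With \<open>K\<close> bounding \<open>\<phi>\<close>, this tolerance keeps the
    error in \<open>\<phi>\<close> below \<open>s * \<phi> v\<close>, which would make
    \<open>\<phi> (Q - P)\<close> positive.\<close>
  have "0 < \<phi> v / K" using K \<open>\<not> \<phi> v \<le> 0\<close> by simp
  then obtain Q s where Qs: "Q \<in> G" "0 < s" "s < \<phi> v / K" "norm (Q - P - s *\<^sub>R v) < \<phi> v / K * s"
    by (rule contingentD[OF assms(3)])
  have "\<bar>\<phi> (Q - P) - s * \<phi> v\<bar> \<le> norm (Q - P - s *\<^sub>R v) * K"
    using K(2)[of "Q - P - s *\<^sub>R v"] by (simp add: diff scaleR)
  also have "\<dots> < \<phi> v / K * s * K" using Qs(4) K(1) by (rule mult_strict_right_mono)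
  also have "\<dots> = s * \<phi> v" using K(1) by simp
  finally show False using assms(2)[OF Qs(1)] by linarith
qed

lemma contingent_Int_ball:
  assumes "0 < d"
  shows "contingent G P = contingent (G \<inter> ball P d) P"
proof
  show "contingent G P \<subseteq> contingent (G \<inter> ball P d) P"
  proof
    fix v assume v: "v \<in> contingent G P"
    show "v \<in> contingent (G \<inter> ball P d) P"
      unfolding contingent_def
    proof (intro CollectI allI impI)
      fix e :: real assume e: "0 < e"
      \<comment> \<open>The bound 1 makes the error at most \<open>s\<close>, so
        \<open>norm (Q - P) < s * (norm v + 1)\<close>; the last bound then puts \<open>Q\<close>
        into the ball.\<close>
      define e' where "e' = min e (min 1 (d / (norm v + 1)))"
      have nv: "0 < norm v + 1" by (simp add: add_nonneg_pos)
      have "0 < e'" using e assms nv by (simp add: e'_def)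
      then obtain Q s where Qs: "Q \<in> G" "0 < s" "s < e'" "norm (Q - P - s *\<^sub>R v) < e' * s"
        by (rule contingentD[OF v])
      have e's: "e' * s \<le> e * s" "e' * s \<le> 1 * s" using Qs(2) by (auto simp: e'_def intro!: mult_right_mono)
      have "norm (Q - P) \<le> norm (Q - P - s *\<^sub>R v) + norm (s *\<^sub>R v)"
        using norm_triangle_ineq[of "Q - P - s *\<^sub>R v" "s *\<^sub>R v"] by simp
      also have "\<dots> < s * (norm v + 1)"
        using less_le_trans[OF Qs(4) e's(2)] Qs(2) by (simp add: distrib_left)
      also have "\<dots> \<le> d"
        using Qs(3) nv by (simp add: e'_def pos_less_divide_eq less_imp_le)
      finally have "Q \<in> ball P d" by (simp add: dist_norm norm_minus_commute)
      moreover have "s < e" using Qs(3) by (simp add: e'_def)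
      ultimately show "\<exists>Q\<in>G \<inter> ball P d. \<exists>s. 0 < s \<and> s < e \<and> norm (Q - P - s *\<^sub>R v) < e * s"
        using Qs(1,2) less_le_trans[OF Qs(4) e's(1)] by (intro bexI[of _ Q] exI[of _ s]) auto
    qed
  qed
qed (simp add: contingent_mono)

text \<open>Put \<open>b = Q - P\<close>. Squaring the hypothesis gives
  \<open>2 * (a \<bullet> b) \<le> (norm b)\<^sup>2\<close>. The left side is
  \<open>2 * s * (a \<bullet> v)\<close> up to a small multiple of \<open>s\<close>, the right side
  is of order \<open>s\<^sup>2\<close>; small \<open>s\<close> excludes
  \<open>a \<bullet> v > 0\<close>.\<close>

lemma inner_contingent_nonpos:
  fixes P a :: "'a::real_inner"
  assumes far: "\<And>Q. Q \<in> G \<Longrightarrow> norm a \<le> norm (a - (Q - P))" and v: "v \<in> contingent G P"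
  shows "a \<bullet> v \<le> 0"
proof (rule ccontr)
  assume "\<not> a \<bullet> v \<le> 0"
  then have av: "0 < a \<bullet> v" by simp
  \<comment> \<open>\<open>k\<close> collects the coefficients of \<open>e * s\<close>:
    \<open>2 * norm a\<close> from the inner product and \<open>(norm v + 1)\<^sup>2\<close> from
    the square of \<open>norm b\<close>. The choice of \<open>e\<close> then gives
    \<open>e * k \<le> a \<bullet> v\<close>, half of what the inequality would need.\<close>
  define k where "k = 2 * norm a + (norm v + 1)\<^sup>2"
  have k: "0 < k" unfolding k_def by (intro add_nonneg_pos zero_less_power) (auto simp: add_nonneg_pos)
  define e where "e = min 1 (a \<bullet> v / k)"
  have "0 < e" using av k by (simp add: e_def)
  then obtain Q s where Qs: "Q \<in> G" "0 < s" "s < e" "norm (Q - P - s *\<^sub>R v) < e * s"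
    by (rule contingentD[OF v])
  define b where "b = Q - P"
  have e1: "e * s \<le> s" using Qs(2) mult_right_mono[of e 1 s] by (simp add: e_def)
  have "norm b \<le> norm (b - s *\<^sub>R v) + norm (s *\<^sub>R v)"
    using norm_triangle_ineq[of "b - s *\<^sub>R v" "s *\<^sub>R v"] by simp
  also have "\<dots> \<le> s * (norm v + 1)"
    using less_le_trans[OF Qs(4) e1] Qs(2) by (simp add: distrib_left b_def)
  finally have "(norm b)\<^sup>2 \<le> (s * (norm v + 1))\<^sup>2" by (rule power_mono) simp
  also have "\<dots> = s * (norm v + 1)\<^sup>2 * s" by (simp add: power2_eq_square algebra_simps)
  also have "\<dots> \<le> e * (norm v + 1)\<^sup>2 * s" using Qs(2,3) by (intro mult_right_mono) auto
  finally have b2: "(norm b)\<^sup>2 \<le> e * (norm v + 1)\<^sup>2 * s" .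
  have "(norm a)\<^sup>2 \<le> (norm (a - b))\<^sup>2" using far[OF Qs(1)] by (intro power_mono) (auto simp: b_def)
  then have "2 * (a \<bullet> b) \<le> (norm b)\<^sup>2"
    by (simp add: power2_norm_eq_inner inner_diff_left inner_diff_right inner_commute)
  moreover have "s * (a \<bullet> v) - a \<bullet> b \<le> norm a * (e * s)"
  proof -
    have "s * (a \<bullet> v) - a \<bullet> b = a \<bullet> (s *\<^sub>R v - b)" by (simp add: inner_diff_right)
    also have "\<dots> \<le> norm a * norm (s *\<^sub>R v - b)" by (rule norm_cauchy_schwarz)
    also have "\<dots> \<le> norm a * (e * s)"
      using Qs(4) by (intro mult_left_mono) (auto simp: b_def norm_minus_commute)
    finally show ?thesis .
  qed
  ultimately have "2 * (s * (a \<bullet> v)) \<le> e * (norm v + 1)\<^sup>2 * s + 2 * (norm a * (e * s))"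
    using b2 by linarith
  also have "\<dots> = e * k * s" by (simp add: k_def algebra_simps)
  also have "\<dots> \<le> (a \<bullet> v) * s"
    using Qs(2) k by (intro mult_right_mono) (auto simp: e_def min_def field_simps)
  finally have "s * (a \<bullet> v) \<le> 0" by (simp add: mult.commute)
  then show False using mult_pos_pos[OF Qs(2) av] by simp
qed

text \<open>If the directions stayed away from \<open>u\<close> along a sequence, a subsequence of
  them would converge to another unit vector of the contingent.\<close>

lemma tendsto_sgn_unique_contingent:
  fixes \<psi> :: "real \<Rightarrow> 'a::euclidean_space"
  assumes cont: "(\<psi> \<longlongrightarrow> P) (at y within A)" and ne: "\<And>x. x \<in> A \<Longrightarrow> \<psi> x \<noteq> P"
    and unique: "\<And>w. w \<in> contingent (\<psi> ` A) P \<Longrightarrow> norm w = 1 \<Longrightarrow> w = u"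
  shows "((\<lambda>x. sgn (\<psi> x - P)) \<longlongrightarrow> u) (at y within A)"
proof (rule ccontr)
  assume "\<not> ?thesis"
  then obtain e where e: "0 < e" "\<And>d. 0 < d \<Longrightarrow> \<exists>x\<in>A. 0 < dist x y \<and> dist x y < d \<and> e \<le> dist (sgn (\<psi> x - P)) u"
    unfolding Lim_within by (force simp: not_less)
  have "\<exists>x. x \<in> A \<and> 0 < dist x y \<and> dist x y < inverse (real (Suc n)) \<and> e \<le> dist (sgn (\<psi> x - P)) u" for n
    using e(2)[of "inverse (real (Suc n))"] by auto
  then obtain X where X: "\<And>n. X n \<in> A" "\<And>n. 0 < dist (X n) y" "\<And>n. dist (X n) y < inverse (real (Suc n))"
      "\<And>n. e \<le> dist (sgn (\<psi> (X n) - P)) u"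
    by metis
  have "\<forall>\<^sub>F n in sequentially. dist (X n) y \<le> inverse (real (Suc n))"
    by (intro always_eventually allI less_imp_le X(3))
  then have "(\<lambda>n. dist (X n) y) \<longlonglongrightarrow> 0"
    by (rule tendsto_sandwich[OF _ _ tendsto_const LIMSEQ_inverse_real_of_nat, rotated]) simp
  then have "X \<longlonglongrightarrow> y" by (rule tendsto_dist_iff[THEN iffD2])
  moreover have "\<forall>n. X n \<in> A - {y}" using X(1,2) by auto
  ultimately have "(\<lambda>n. \<psi> (X n)) \<longlonglongrightarrow> P"
    using cont[unfolded tendsto_at_iff_sequentially, THEN spec[of _ X]] by (simp add: o_def)
  moreover have "\<psi> (X n) \<in> \<psi> ` A" "\<psi> (X n) \<noteq> P" for n using X(1) ne by auto
  ultimately obtain w r where w: "w \<in> contingent (\<psi> ` A) P" "norm w = 1" "strict_mono (r :: nat \<Rightarrow> nat)"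
    "(\<lambda>n. sgn (\<psi> (X (r n)) - P)) \<longlonglongrightarrow> w"
    using contingent_subsequence[of "\<lambda>n. \<psi> (X n)" "\<psi> ` A" P] by metis
  have "w = u" using w(1,2) by (rule unique)
  then have "\<forall>\<^sub>F n in sequentially. dist (sgn (\<psi> (X (r n)) - P)) u < e"
    using tendstoD[OF w(4) e(1)] by simp
  then obtain n where "dist (sgn (\<psi> (X (r n)) - P)) u < e"
    using eventually_happens'[OF sequentially_bot] by blast
  then show False using X(4)[of "r n"] by simp
qed

text \<open>The segment from \<open>u\<close> to \<open>v\<close> is connected and covered by two
  closed sets that both meet it, so they share a point \<open>w\<close> of it. Then
  \<open>w \<bullet> w \<le> 0\<close>, so 0 is a convex combination of the unit vectors
  \<open>u\<close> and \<open>v\<close>, with equal weights by comparing norms.\<close>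

lemma opposite_if_convex_Un:
  fixes L R :: "'a::real_inner set"
  assumes "closed L" "closed R" "convex (L \<union> R)" and dot: "\<And>u v. u \<in> L \<Longrightarrow> v \<in> R \<Longrightarrow> u \<bullet> v \<le> 0"
    and u: "u \<in> L" "norm u = 1" and v: "v \<in> R" "norm v = 1"
  shows "v = - u"
proof -
  have "closed_segment u v \<subseteq> L \<union> R" using assms by (intro closed_segment_subset) auto
  moreover have "L \<inter> closed_segment u v \<noteq> {}" "R \<inter> closed_segment u v \<noteq> {}" using u v by auto
  ultimately have "L \<inter> R \<inter> closed_segment u v \<noteq> {}"
    using connected_segment[of u v] assms(1,2) unfolding connected_closed by meson
  then obtain w where w: "w \<in> L" "w \<in> R" "w \<in> closed_segment u v" by blast
  then have "w = 0" using dot[OF w(1,2)] by (metis inner_ge_zero inner_eq_zero_iff order_antisym)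
  then obtain t where t: "0 \<le> t" "t \<le> 1" "(1 - t) *\<^sub>R u + t *\<^sub>R v = 0"
    using w(3) unfolding closed_segment_def by auto
  then have eq: "t *\<^sub>R v = (- (1 - t)) *\<^sub>R u"
    unfolding scaleR_minus_left eq_neg_iff_add_eq_0 by (simp only: add.commute)
  then have "norm (t *\<^sub>R v) = norm ((- (1 - t)) *\<^sub>R u)" by simp
  then have "t = 1 - t" using t u v by (simp only: norm_scaleR) simp
  then have "t = 1 / 2" by simp
  with eq have "(1 / 2 :: real) *\<^sub>R v = (1 / 2 :: real) *\<^sub>R (- u)" by (simp only: scaleR_minus_left scaleR_minus_right) simp
  then show ?thesis by (subst (asm) scaleR_cancel_left) simp
qed

section \<open>Convexity of the contingent almost everywhere\<close>

text \<open>McShane's extension: the lower envelope of the cones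
  \<open>f t + L * dist x t\<close>.\<close>

lemma lipschitz_extend_real:
  fixes f :: "'a::metric_space \<Rightarrow> real"
  assumes "L-lipschitz_on T f"
  obtains F where "L-lipschitz_on UNIV F" "\<And>t. t \<in> T \<Longrightarrow> F t = f t"
proof (cases "T = {}")
  case True
  have "L-lipschitz_on UNIV (\<lambda>_::'a. 0::real)"
    using lipschitz_on_nonneg[OF assms] by (intro lipschitz_onI) simp_all
  then show ?thesis by (rule that) (simp add: True)
next
  case False
  then obtain t0 where t0: "t0 \<in> T" by blast
  have L: "0 \<le> L" using lipschitz_on_nonneg[OF assms] .
  have lip: "\<bar>f s - f t\<bar> \<le> L * dist s t" if "s \<in> T" "t \<in> T" for s t
    using lipschitz_onD[OF assms that] by (simp add: dist_real_def)
  define F where "F x = (INF t\<in>T. f t + L * dist x t)" for x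
  have bdd: "bdd_below ((\<lambda>t. f t + L * dist x t) ` T)" for x
  proof (rule bdd_belowI2)
    fix t assume "t \<in> T"
    have "L * dist t0 t \<le> L * (dist x t0 + dist x t)"
      using L dist_triangle2[of t0 t x] by (intro mult_left_mono) (auto simp: dist_commute)
    then show "f t0 - L * dist x t0 \<le> f t + L * dist x t"
      using lip[OF t0 \<open>t \<in> T\<close>] by (simp add: distrib_left)
  qed
  have le: "F x \<le> F y + L * dist x y" for x y
  proof -
    have "F x - L * dist x y \<le> (INF t\<in>T. f t + L * dist y t)"
    proof (rule cINF_greatest[OF False])
      fix t assume t: "t \<in> T"
      have "F x \<le> f t + L * dist x t" unfolding F_def by (rule cINF_lower[OF bdd t])
      also have "L * dist x t \<le> L * (dist x y + dist y t)"
        using L dist_triangle by (intro mult_left_mono) auto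
      finally show "F x - L * dist x y \<le> f t + L * dist y t" by (simp add: distrib_left)
    qed
    then show ?thesis by (simp add: F_def)
  qed
  show ?thesis
  proof
    show "L-lipschitz_on UNIV F"
    proof (rule lipschitz_onI[OF _ L])
      show "dist (F x) (F y) \<le> L * dist x y" for x y
        using le[of x y] le[of y x] by (simp add: dist_real_def abs_le_iff dist_commute)
    qed
    fix t assume t: "t \<in> T"
    have "F t \<le> f t + L * dist t t" unfolding F_def by (rule cINF_lower[OF bdd t])
    moreover have "f t \<le> F t" unfolding F_def
    proof (rule cINF_greatest[OF False])
      fix s assume "s \<in> T" then show "f t \<le> f s + L * dist t s" using lip[OF t \<open>s \<in> T\<close>] by linarith
    qed
    ultimately show "F t = f t" by simp
  qed
qed

text \<open>The distance to \<open>T\<close> is itself Lipschitz and minimal on \<open>T\<close>, so wherever it is differentiable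
  its derivative there is 0. This replaces the density theorem: near almost every \<open>t \<in> T\<close> there are
  points of \<open>T\<close> within \<open>o(s)\<close> of every \<open>t + s l\<close>.\<close>

lemma lipschitz_curve_tangent:
  fixes h :: "real \<Rightarrow> real \<times> real"
  assumes h: "M-lipschitz_on T h"
  obtains N where "negligible N"
    "\<And>t. t \<in> T - N \<Longrightarrow> \<exists>\<tau>. \<forall>l. \<forall>e>0. \<exists>d>0. \<forall>s. 0 < s \<and> s < d \<longrightarrow>
        (\<exists>t'\<in>T. norm (h t' - h t - (s * l) *\<^sub>R \<tau>) \<le> e * s \<and> \<bar>t' - t - s * l\<bar> \<le> e * s)"
proof -
  have M: "0 \<le> M" using lipschitz_on_nonneg[OF h] .
  have "M-lipschitz_on T (\<lambda>t. fst (h t))" "M-lipschitz_on T (\<lambda>t. snd (h t))"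
    using h unfolding lipschitz_on_def by (meson dist_fst_le dist_snd_le order_trans)+
  note lip = this
  \<comment> \<open>The coordinates are extended to the whole line so that almost everywhere
    differentiability applies to them.\<close>
  obtain F1 where F1: "M-lipschitz_on UNIV F1" "\<And>t. t \<in> T \<Longrightarrow> F1 t = fst (h t)"
    by (rule lipschitz_extend_real[OF lip(1)]) (assumption | rule that)+
  obtain F2 where F2: "M-lipschitz_on UNIV F2" "\<And>t. t \<in> T \<Longrightarrow> F2 t = snd (h t)"
    by (rule lipschitz_extend_real[OF lip(2)]) (assumption | rule that)+
  define D where "D x = infdist x T" for x
  have D: "1-lipschitz_on UNIV D"
  proof (rule lipschitz_onI)
    show "dist (D x) (D y) \<le> 1 * dist x y" for x y
      using infdist_triangle[of x T y] infdist_triangle[of y T x]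
      by (simp add: D_def dist_real_def abs_le_iff)
  qed simp
  define N where "N = {x. \<not> F1 differentiable (at x)} \<union> {x. \<not> F2 differentiable (at x)} \<union> {x. \<not> D differentiable (at x)}"
  have "negligible N"
    unfolding N_def by (intro negligible_Un lipschitz_negligible_not_differentiable[OF F1(1)]
        lipschitz_negligible_not_differentiable[OF F2(1)] lipschitz_negligible_not_differentiable[OF D])
  moreover have "\<exists>\<tau>. \<forall>l. \<forall>e>0. \<exists>d>0. \<forall>s. 0 < s \<and> s < d \<longrightarrow>
        (\<exists>t'\<in>T. norm (h t' - h t - (s * l) *\<^sub>R \<tau>) \<le> e * s \<and> \<bar>t' - t - s * l\<bar> \<le> e * s)" if t: "t \<in> T - N" for t
  proof -
    obtain \<tau>1 \<tau>2 \<delta> where der: "(F1 has_real_derivative \<tau>1) (at t)" "(F2 has_real_derivative \<tau>2) (at t)"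
        "(D has_real_derivative \<delta>) (at t)"
      using t unfolding N_def real_differentiable_def by auto
    have D0: "D t = 0" using t by (simp add: D_def)
    have "\<delta> = 0"
      by (rule DERIV_local_min[OF der(3), of 1]) (auto simp: D0, simp add: D_def infdist_nonneg)
    have approx: "\<exists>d>0. \<forall>y. \<bar>y - t\<bar> < d \<longrightarrow> \<bar>F y - F t - \<tau> * (y - t)\<bar> \<le> e * \<bar>y - t\<bar>"
      if "(F has_real_derivative \<tau>) (at t)" "0 < e" for F \<tau> e
      using that unfolding has_field_derivative_def has_derivative_at_alt by auto
    have "\<exists>d>0. \<forall>s. 0 < s \<and> s < d \<longrightarrow>
        (\<exists>t'\<in>T. norm (h t' - h t - (s * l) *\<^sub>R (\<tau>1, \<tau>2)) \<le> e * s \<and> \<bar>t' - t - s * l\<bar> \<le> e * s)"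
      if "0 < e" for l e
    proof (cases "l = 0")
      case True
      then show ?thesis using t \<open>0 < e\<close> by (intro exI[of _ 1]) (auto intro!: bexI[of _ t])
    next
      case False
      \<comment> \<open>With \<open>\<kappa> = \<eta> * s * \<bar>l\<bar>\<close>, the point
        \<open>t'\<close> is within \<open>2 * \<kappa>\<close> of \<open>y = t + s * l\<close>, so
        each coordinate errs by at most \<open>2 * M * \<kappa> + \<kappa>\<close>. The two together
        give \<open>(4 * M + 2) * \<kappa> = e * s\<close>.\<close>
      define \<eta> where "\<eta> = e / ((4 * M + 2) * \<bar>l\<bar>)"
      have M2: "0 < 4 * M + 2" using M by simp
      have \<eta>: "0 < \<eta>" using \<open>0 < e\<close> False M2 by (simp add: \<eta>_def)
      have \<eta>e: "(4 * M + 2) * \<eta> * \<bar>l\<bar> = e" using False M2 by (simp add: \<eta>_def)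
      obtain d1 d2 d3 where d: "0 < d1" "0 < d2" "0 < d3"
        and d1: "\<And>y. \<bar>y - t\<bar> < d1 \<Longrightarrow> \<bar>F1 y - F1 t - \<tau>1 * (y - t)\<bar> \<le> \<eta> * \<bar>y - t\<bar>"
        and d2: "\<And>y. \<bar>y - t\<bar> < d2 \<Longrightarrow> \<bar>F2 y - F2 t - \<tau>2 * (y - t)\<bar> \<le> \<eta> * \<bar>y - t\<bar>"
        and d3: "\<And>y. \<bar>y - t\<bar> < d3 \<Longrightarrow> \<bar>D y - D t - \<delta> * (y - t)\<bar> \<le> \<eta> * \<bar>y - t\<bar>"
        using approx[OF der(1) \<eta>] approx[OF der(2) \<eta>] approx[OF der(3) \<eta>] by (elim exE conjE) blast
      define d where "d = min d1 (min d2 d3) / \<bar>l\<bar>"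
      have "0 < d" using d False by (simp add: d_def)
      moreover have "\<exists>t'\<in>T. norm (h t' - h t - (s * l) *\<^sub>R (\<tau>1, \<tau>2)) \<le> e * s \<and> \<bar>t' - t - s * l\<bar> \<le> e * s"
        if s: "0 < s" "s < d" for s
      proof -
        define y where "y = t + s * l"
        have yt: "y - t = s * l" "\<bar>y - t\<bar> = s * \<bar>l\<bar>" using s by (auto simp: y_def abs_mult)
        have "s * \<bar>l\<bar> < min d1 (min d2 d3)" using s(2) False by (simp add: d_def pos_less_divide_eq)
        then have small: "\<bar>y - t\<bar> < d1" "\<bar>y - t\<bar> < d2" "\<bar>y - t\<bar> < d3" using yt by auto
        have "0 < \<eta> * (s * \<bar>l\<bar>)" using \<eta> s False by simp
        moreover have "infdist y T \<le> \<eta> * (s * \<bar>l\<bar>)"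
          using d3[OF small(3)] \<open>\<delta> = 0\<close> D0 yt by (simp add: D_def infdist_nonneg)
        \<comment> \<open>The factor 2 makes the inequality strict, so that a point of
          \<open>T\<close> realises it although the infimum may not be attained.\<close>
        ultimately have "infdist y T < 2 * (\<eta> * (s * \<bar>l\<bar>))" by linarith
        moreover have "T \<noteq> {}" using t by blast
        moreover have "bdd_below (dist y ` T)" by (rule bdd_belowI2[of _ 0]) simp
        ultimately have "\<exists>t'\<in>T. dist y t' < 2 * (\<eta> * (s * \<bar>l\<bar>))"
          by (simp add: infdist_notempty cINF_less_iff)
        then obtain t' where t': "t' \<in> T" "dist y t' < 2 * (\<eta> * (s * \<bar>l\<bar>))" ..
        define \<kappa> where "\<kappa> = \<eta> * (s * \<bar>l\<bar>)"
        have k: "(4 * M + 2) * \<kappa> = e * s" using \<eta>e by (simp add: \<kappa>_def mult.assoc[symmetric])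
        have k0: "0 < \<kappa>" using \<open>0 < \<eta> * (s * \<bar>l\<bar>)\<close> by (simp add: \<kappa>_def)
        have t'y: "\<bar>t' - y\<bar> \<le> 2 * \<kappa>" using t'(2) by (simp add: \<kappa>_def dist_real_def)
        have "\<bar>F1 t' - F1 y\<bar> \<le> M * \<bar>t' - y\<bar>" "\<bar>F2 t' - F2 y\<bar> \<le> M * \<bar>t' - y\<bar>"
          using lipschitz_onD[OF F1(1)] lipschitz_onD[OF F2(1)] by (auto simp: dist_real_def)
        moreover have "M * \<bar>t' - y\<bar> \<le> M * (2 * \<kappa>)" using t'y M by (intro mult_left_mono)
        moreover have "\<bar>F1 y - F1 t - \<tau>1 * (y - t)\<bar> \<le> \<kappa>" "\<bar>F2 y - F2 t - \<tau>2 * (y - t)\<bar> \<le> \<kappa>"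
          using d1[OF small(1)] d2[OF small(2)] yt by (auto simp: \<kappa>_def)
        ultimately have b: "\<bar>F1 t' - F1 t - \<tau>1 * (y - t)\<bar> \<le> M * (2 * \<kappa>) + \<kappa>"
            "\<bar>F2 t' - F2 t - \<tau>2 * (y - t)\<bar> \<le> M * (2 * \<kappa>) + \<kappa>"
          by linarith+
        have eq: "h t' - h t - (s * l) *\<^sub>R (\<tau>1, \<tau>2) = (F1 t' - F1 t - \<tau>1 * (y - t), F2 t' - F2 t - \<tau>2 * (y - t))"
          using t t' F1(2) F2(2) by (simp add: prod_eq_iff yt mult.commute)
        have "norm (h t' - h t - (s * l) *\<^sub>R (\<tau>1, \<tau>2))
            \<le> norm (F1 t' - F1 t - \<tau>1 * (y - t)) + norm (F2 t' - F2 t - \<tau>2 * (y - t))"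
          unfolding eq by (rule norm_Pair_le)
        also have "\<dots> \<le> (4 * M + 2) * \<kappa>" using b by (simp add: distrib_right)
        finally have "norm (h t' - h t - (s * l) *\<^sub>R (\<tau>1, \<tau>2)) \<le> e * s" using k by simp
        \<comment> \<open>Control of the parameter is kept as well; it later excludes a zero
          tangent.\<close>
        moreover have "\<bar>t' - t - s * l\<bar> \<le> e * s"
        proof -
          have "0 \<le> M * \<kappa>" using M k0 by simp
          then have "2 * \<kappa> \<le> (4 * M + 2) * \<kappa>" by (simp add: distrib_right)
          then show ?thesis using t'y k by (simp add: y_def)
        qed
        ultimately show ?thesis using t'(1) by blast
      qed
      ultimately show ?thesis by blast
    qed
    then show ?thesis by blast
  qed
  ultimately show ?thesis by (rule that)
qed

text \<open>If \<open>Q - P\<close> were close to \<open>s (c' + l \<tau>)\<close>, shift the base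
  point to some \<open>P'\<close> in \<open>B\<close> with \<open>P' - P\<close> close to
  \<open>s l \<tau>\<close>. Then \<open>Q - P'\<close> is close to \<open>s c'\<close>, so
  \<open>Q\<close> lies in the free cone at \<open>P'\<close>.\<close>

lemma contingent_avoids_strip:
  fixes P \<tau> c :: "'a::real_normed_vector"
  assumes dense: "\<And>l e. 0 < e \<Longrightarrow> \<exists>d>0. \<forall>s. 0 < s \<and> s < d \<longrightarrow> (\<exists>P'\<in>B. norm (P' - P - (s * l) *\<^sub>R \<tau>) \<le> e * s)"
    and free: "\<And>P' Q s. P' \<in> B \<Longrightarrow> Q \<in> G \<Longrightarrow> 0 < s \<Longrightarrow> s < r \<Longrightarrow> r * s \<le> norm (Q - P' - s *\<^sub>R c)"
    and "dist c' c < r"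
  shows "c' + l *\<^sub>R \<tau> \<notin> contingent G P"
proof
  assume K: "c' + l *\<^sub>R \<tau> \<in> contingent G P"
  \<comment> \<open>Two errors of \<open>\<eta> * s\<close> and the shift from \<open>c'\<close> to
    \<open>c\<close> stay below \<open>r * s\<close>.\<close>
  define \<eta> where "\<eta> = (r - dist c' c) / 3"
  have \<eta>: "0 < \<eta>" using assms(3) by (simp add: \<eta>_def)
  have r: "0 < r" using assms(3) zero_le_dist[of c' c] by linarith
  obtain d where d: "0 < d" "\<And>s. 0 < s \<Longrightarrow> s < d \<Longrightarrow> \<exists>P'\<in>B. norm (P' - P - (s * l) *\<^sub>R \<tau>) \<le> \<eta> * s"
    using dense[OF \<eta>, of l] by (elim exE conjE) simp
  have "0 < min \<eta> (min d r)" using \<eta> d r by simp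
  then obtain Q s where Qs: "Q \<in> G" "0 < s" "s < min \<eta> (min d r)"
      "norm (Q - P - s *\<^sub>R (c' + l *\<^sub>R \<tau>)) < min \<eta> (min d r) * s"
    by (rule contingentD[OF K])
  obtain P' where P': "P' \<in> B" "norm (P' - P - (s * l) *\<^sub>R \<tau>) \<le> \<eta> * s"
    using d(2)[of s] Qs by auto
  have "Q - P' - s *\<^sub>R c = (Q - P - s *\<^sub>R (c' + l *\<^sub>R \<tau>)) - (P' - P - (s * l) *\<^sub>R \<tau>) + s *\<^sub>R (c' - c)"
    by (simp add: algebra_simps)
  note eq = this
  have tri: "norm (x - y + z) \<le> norm x + norm y + norm z" for x y z :: 'a
    using norm_triangle_ineq[of "x - y" z] norm_triangle_ineq4[of x y] by linarith
  have "norm (Q - P' - s *\<^sub>R c) \<le> norm (Q - P - s *\<^sub>R (c' + l *\<^sub>R \<tau>)) + norm (P' - P - (s * l) *\<^sub>R \<tau>) + norm (s *\<^sub>R (c' - c))"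
    unfolding eq by (rule tri)
  also have "norm (s *\<^sub>R (c' - c)) = s * dist c' c" using Qs(2) by (simp add: dist_norm)
  also have "norm (Q - P - s *\<^sub>R (c' + l *\<^sub>R \<tau>)) \<le> \<eta> * s"
    using Qs(2,4) mult_right_mono[of "min \<eta> (min d r)" \<eta> s] by linarith
  also note P'(2)
  finally have "norm (Q - P' - s *\<^sub>R c) \<le> \<eta> * s + \<eta> * s + s * dist c' c" by simp
  also have "\<dots> = (\<eta> + \<eta> + dist c' c) * s" by (simp add: algebra_simps)
  also have "\<dots> < r * s"
    using Qs(2) \<eta> by (intro mult_strict_right_mono) (auto simp: \<eta>_def field_simps)
  finally show False using free[OF P'(1) Qs(1,2)] Qs(3) by simp
qed

section \<open>Orientation and half-planes in the plane\<close>

text \<open>The oriented area. \<open>det2 c\<close> is \<open>norm c\<close> times the coordinate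
  orthogonal to \<open>c\<close>, and the sign of \<open>det2 \<tau>\<close> tells the sides of the
  line along \<open>\<tau>\<close> apart.\<close>

definition det2 :: "real \<times> real \<Rightarrow> real \<times> real \<Rightarrow> real" where
  "det2 x y = fst x * snd y - snd x * fst y"

lemma det2_diff: "det2 x (y - z) = det2 x y - det2 x z"
  and det2_add: "det2 x (y + z) = det2 x y + det2 x z"
  and det2_scaleR: "det2 x (k *\<^sub>R y) = k * det2 x y"
  by (simp_all add: det2_def algebra_simps)

lemma norm_Pair_power2: "(norm (x :: real \<times> real))\<^sup>2 = (fst x)\<^sup>2 + (snd x)\<^sup>2"
  by (simp add: norm_prod_def)

lemma inner_pair: "x \<bullet> (y :: real \<times> real) = fst x * fst y + snd x * snd y"
  by (simp add: inner_prod_def)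

text \<open>Lagrange's identity; for orthogonal vectors it turns \<open>\<bar>det2 x y\<bar>\<close>
  into \<open>norm x * norm y\<close>.\<close>

lemma det2_inner_norm: "(det2 x y)\<^sup>2 + (x \<bullet> y)\<^sup>2 = (norm x)\<^sup>2 * (norm y)\<^sup>2"
  unfolding norm_Pair_power2 inner_pair det2_def by algebra

lemma abs_det2_le: "\<bar>det2 x y\<bar> \<le> norm x * norm y"
proof (rule power2_le_imp_le)
  have "(det2 x y)\<^sup>2 \<le> (norm x)\<^sup>2 * (norm y)\<^sup>2"
    using det2_inner_norm[of x y] zero_le_power2[of "x \<bullet> y"] by linarith
  then show "\<bar>det2 x y\<bar>\<^sup>2 \<le> (norm x * norm y)\<^sup>2" by (simp add: power_mult_distrib)
qed simp

lemma det2_eq_0_imp_parallel: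
  assumes "det2 \<tau> w = 0" "\<tau> \<noteq> 0"
  shows "\<exists>k. w = k *\<^sub>R \<tau>"
proof -
  obtain a b where \<tau>: "\<tau> = (a, b)" by fastforce
  obtain x y where w: "w = (x, y)" by fastforce
  have eq: "a * y = b * x" using assms(1) by (simp add: det2_def \<tau> w)
  show ?thesis
  proof (cases "a = 0")
    case True
    then have "w = (y / b) *\<^sub>R \<tau>" using eq assms(2) by (auto simp: \<tau> w zero_prod_def)
    then show ?thesis ..
  next
    case False
    then have "w = (x / a) *\<^sub>R \<tau>" using eq by (auto simp: \<tau> w field_simps)
    then show ?thesis ..
  qed
qed

text \<open>The contingent is a cone, so avoiding the line through \<open>a u + b v\<close> in direction \<open>\<tau>\<close> it
  avoids the whole open half-plane on that side of \<open>\<tau>\<close>; but \<open>u\<close> or \<open>v\<close> must lie there.\<close>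

lemma contingent_half_plane:
  fixes \<tau> :: "real \<times> real"
  assumes "\<tau> \<noteq> 0" "P \<in> G" and uv: "u \<in> contingent G P" "v \<in> contingent G P" and ab: "0 \<le> a" "0 \<le> b"
    and avoid: "\<And>l. (a *\<^sub>R u + b *\<^sub>R v) + l *\<^sub>R \<tau> \<notin> contingent G P"
  shows False
proof -
  define c where "c = a *\<^sub>R u + b *\<^sub>R v"
  \<comment> \<open>If \<open>c\<close> were parallel to \<open>\<tau>\<close>, the avoided line
    would pass through 0, which is in the contingent.\<close>
  have nz: "det2 \<tau> c \<noteq> 0"
  proof
    assume "det2 \<tau> c = 0"
    then obtain k where "c = k *\<^sub>R \<tau>" using det2_eq_0_imp_parallel assms(1) by blast
    then have "c + (- k) *\<^sub>R \<tau> = 0" by simp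
    then show False using avoid[of "- k"] zero_in_contingent[OF assms(2)] by (simp add: c_def)
  qed
  \<comment> \<open>A vector on the same side of \<open>\<tau>\<close> as \<open>c\<close> can be
    rescaled by a positive factor onto the avoided line.\<close>
  have same_side: False if w: "w \<in> contingent G P" and pos: "0 < det2 \<tau> w / det2 \<tau> c" for w
  proof -
    define k where "k = det2 \<tau> w / det2 \<tau> c"
    have "det2 \<tau> w \<noteq> 0" using pos by auto
    then have "det2 \<tau> ((1 / k) *\<^sub>R w - c) = 0"
      using nz by (simp add: det2_diff det2_scaleR k_def)
    then obtain l where "(1 / k) *\<^sub>R w - c = l *\<^sub>R \<tau>" using det2_eq_0_imp_parallel assms(1) by blast
    then have "(1 / k) *\<^sub>R w = c + l *\<^sub>R \<tau>" by (simp add: algebra_simps)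
    moreover have "(1 / k) *\<^sub>R w \<in> contingent G P"
      using w pos by (intro contingent_scaleR) (simp_all only: k_def zero_less_divide_1_iff)
    ultimately show False using avoid[of l] by (simp add: c_def)
  qed
  have "det2 \<tau> u / det2 \<tau> c \<le> 0" "det2 \<tau> v / det2 \<tau> c \<le> 0"
    using same_side uv not_le by blast+
  then have "a * (det2 \<tau> u / det2 \<tau> c) + b * (det2 \<tau> v / det2 \<tau> c) \<le> 0"
    using ab by (intro add_nonpos_nonpos mult_nonneg_nonpos)
  \<comment> \<open>The weighted ratios add up to 1, so they cannot both be nonpositive.\<close>
  moreover have "a * (det2 \<tau> u / det2 \<tau> c) + b * (det2 \<tau> v / det2 \<tau> c) = det2 \<tau> c / det2 \<tau> c"
    by (simp add: add_divide_distrib[symmetric]) (simp add: c_def det2_add det2_scaleR)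
  ultimately show False using nz by simp
qed

text \<open>Split \<open>D = P' - P\<close> into \<open>s c\<close> and a part orthogonal to
  \<open>c\<close>. The free cones force the orthogonal part to be at least
  \<open>r * \<bar>s\<bar>\<close>, so it controls all of \<open>D\<close>; its length is
  \<open>\<bar>det2 c D\<bar> / norm c\<close>.\<close>

lemma cone_free_norm_le:
  fixes P P' c :: "real \<times> real"
  assumes r: "0 < r" "r \<le> norm c" and small: "norm (P' - P) < r\<^sup>2"
    and free: "\<And>s. 0 < s \<Longrightarrow> s < r \<Longrightarrow> r * s \<le> norm (P' - P - s *\<^sub>R c)"
      "\<And>s. 0 < s \<Longrightarrow> s < r \<Longrightarrow> r * s \<le> norm (P - P' - s *\<^sub>R c)"
  shows "norm (P' - P) \<le> (1 + norm c / r) / norm c * \<bar>det2 c (P' - P)\<bar>"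
proof -
  define D where "D = P' - P"
  \<comment> \<open>The coefficient of the orthogonal projection onto \<open>c\<close>;
    \<open>norm D < r\<^sup>2\<close> and \<open>r \<le> norm c\<close> make it admissible as a
    scale below \<open>r\<close>.\<close>
  define s where "s = (c \<bullet> D) / (norm c)\<^sup>2"
  have c: "0 < norm c" using r by linarith
  have "\<bar>c \<bullet> D\<bar> \<le> norm c * norm D" by (rule Cauchy_Schwarz_ineq2)
  then have "\<bar>s\<bar> \<le> norm D / norm c" using c by (simp add: s_def field_simps power2_eq_square)
  also have "\<dots> < r\<^sup>2 / norm c" using small c by (simp add: D_def divide_strict_right_mono)
  also have "\<dots> \<le> r" using r c by (simp add: field_simps power2_eq_square)
  finally have s: "\<bar>s\<bar> < r" .
  \<comment> \<open>The cone at \<open>P\<close> serves for positive \<open>s\<close>, the cone at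
    \<open>P'\<close> for negative \<open>s\<close>.\<close>
  have perp: "r * \<bar>s\<bar> \<le> norm (D - s *\<^sub>R c)"
  proof (cases s "0::real" rule: linorder_cases)
    case less
    have "norm (P - P' - (- s) *\<^sub>R c) = norm (- (D - s *\<^sub>R c))" by (simp add: D_def algebra_simps)
    then show ?thesis using free(2)[of "- s"] less s by (simp only: norm_minus_cancel) simp
  next
    case greater then show ?thesis using free(1)[of s] s by (simp add: D_def)
  qed simp
  have "c \<bullet> (D - s *\<^sub>R c) = 0"
    using c by (simp add: inner_diff_right s_def dot_square_norm)
  moreover have "det2 c (D - s *\<^sub>R c) = det2 c D"
    by (simp add: det2_diff det2_scaleR) (simp add: det2_def)
  ultimately have "(det2 c D)\<^sup>2 = (norm c * norm (D - s *\<^sub>R c))\<^sup>2"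
    using det2_inner_norm[of c "D - s *\<^sub>R c"] by (simp add: power_mult_distrib)
  then have "\<bar>det2 c D\<bar>\<^sup>2 = (norm c * norm (D - s *\<^sub>R c))\<^sup>2" by simp
  then have "\<bar>det2 c D\<bar> = norm c * norm (D - s *\<^sub>R c)"
    by (rule power2_eq_imp_eq) simp_all
  then have nD: "norm (D - s *\<^sub>R c) = \<bar>det2 c D\<bar> / norm c" using c by simp
  have "norm D \<le> norm (D - s *\<^sub>R c) + norm (s *\<^sub>R c)"
    using norm_triangle_ineq[of "D - s *\<^sub>R c" "s *\<^sub>R c"] by simp
  also have "norm (s *\<^sub>R c) = \<bar>s\<bar> * norm c" by simp
  also have "\<dots> \<le> norm (D - s *\<^sub>R c) / r * norm c"
    using perp r by (intro mult_right_mono) (auto simp: field_simps)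
  also have "norm (D - s *\<^sub>R c) + norm (D - s *\<^sub>R c) / r * norm c = (1 + norm c / r) * norm (D - s *\<^sub>R c)"
    by (simp add: algebra_simps)
  finally show ?thesis unfolding nD by (simp add: D_def)
qed

text \<open>On \<open>B\<close> the function \<open>det2 c\<close> has a Lipschitz inverse
  \<open>h\<close>, so \<open>B\<close> is a Lipschitz curve over \<open>T\<close>. Outside a null
  set of parameters there is a tangent \<open>\<tau>\<close>; there the contingent misses the whole
  line through \<open>a u + b v\<close> along \<open>\<tau>\<close>, which the half-plane argument
  forbids. The bad points thus lie in the image of a null set.\<close>

lemma hausdorff1_null_cone_free_piece:
  fixes B G :: "(real \<times> real) set"
  assumes "B \<subseteq> G" and r: "0 < r"
    and free: "\<And>P Q s. P \<in> B \<Longrightarrow> Q \<in> G \<Longrightarrow> 0 < s \<Longrightarrow> s < r \<Longrightarrow> r * s \<le> norm (Q - P - s *\<^sub>R c)"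
    and small: "\<And>P P'. P \<in> B \<Longrightarrow> P' \<in> B \<Longrightarrow> norm (P' - P) < r\<^sup>2"
  shows "hausdorff1 {P \<in> B. \<exists>u\<in>contingent G P. \<exists>v\<in>contingent G P. \<exists>a\<ge>0. \<exists>b\<ge>0. dist (a *\<^sub>R u + b *\<^sub>R v) c < r} = 0"
    (is "hausdorff1 ?bad = 0")
proof (cases "B = {}")
  case True
  then have "?bad \<subseteq> {}" by blast
  then show ?thesis by (rule hausdorff1_null_subset[OF hausdorff1_empty])
next
  case False
  then obtain P0 where P0: "P0 \<in> B" by blast
  \<comment> \<open>Freeness of the cone at \<open>P0\<close> applied to \<open>Q = P0\<close>
    itself yields \<open>r \<le> norm c\<close>, in particular \<open>c \<noteq> 0\<close>.\<close>
  have "r * (r / 2) \<le> norm (P0 - P0 - (r / 2) *\<^sub>R c)"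
    using P0 assms(1) r by (intro free) auto
  then have rc: "r \<le> norm c" using r by (simp add: field_simps)
  then have c: "0 < norm c" using r by linarith
  define M where "M = (1 + norm c / r) / norm c"
  have M: "0 \<le> M" using r by (simp add: M_def)
  have bilip: "norm (P' - P) \<le> M * \<bar>det2 c P' - det2 c P\<bar>" if "P \<in> B" "P' \<in> B" for P P'
  proof -
    have "norm (P' - P) \<le> M * \<bar>det2 c (P' - P)\<bar>"
      unfolding M_def using that assms(1) by (intro cone_free_norm_le[OF r rc small] free) auto
    then show ?thesis by (simp add: det2_diff)
  qed
  have inj: "inj_on (det2 c) B"
  proof (rule inj_onI)
    fix P P' assume "P \<in> B" "P' \<in> B" "det2 c P = det2 c P'"
    then show "P = P'" using bilip[of P P'] by simp
  qed
  define h where "h = inv_into B (det2 c)"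
  define T where "T = det2 c ` B"
  have hP: "h (det2 c P) = P" if "P \<in> B" for P
    using inj that by (simp add: h_def)
  have lip: "M-lipschitz_on T h"
  proof (rule lipschitz_onI[OF _ M])
    fix s t assume "s \<in> T" "t \<in> T"
    then obtain P P' where "P \<in> B" "P' \<in> B" "s = det2 c P" "t = det2 c P'" by (auto simp: T_def)
    then show "dist (h s) (h t) \<le> M * dist s t"
      using bilip[of P' P] by (simp add: hP dist_norm)
  qed
  obtain N where N: "negligible N" and tangent: "\<forall>t\<in>T - N. \<exists>\<tau>. \<forall>l. \<forall>e>0. \<exists>d>0. \<forall>s. 0 < s \<and> s < d \<longrightarrow>
        (\<exists>t'\<in>T. norm (h t' - h t - (s * l) *\<^sub>R \<tau>) \<le> e * s \<and> \<bar>t' - t - s * l\<bar> \<le> e * s)"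
    using lipschitz_curve_tangent[OF lip] by (metis (no_types, lifting))
  have "?bad \<subseteq> h ` (T \<inter> N)"
  proof
    fix P assume "P \<in> ?bad"
    then obtain u v a b where P: "P \<in> B" and bad: "u \<in> contingent G P" "v \<in> contingent G P" "0 \<le> a" "0 \<le> b"
      "dist (a *\<^sub>R u + b *\<^sub>R v) c < r" by blast
    define t where "t = det2 c P"
    have t: "t \<in> T" "h t = P" using P by (auto simp: t_def T_def hP)
    have "t \<in> N"
    proof (rule ccontr)
      assume "t \<notin> N"
      then have "t \<in> T - N" using t by simp
      then obtain \<tau> where \<tau>: "\<forall>l. \<forall>e>0. \<exists>d>0. \<forall>s. 0 < s \<and> s < d \<longrightarrow>
          (\<exists>t'\<in>T. norm (h t' - h t - (s * l) *\<^sub>R \<tau>) \<le> e * s \<and> \<bar>t' - t - s * l\<bar> \<le> e * s)"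
        using tangent by blast
      \<comment> \<open>With \<open>\<tau> = 0\<close> the curve would move by at most
        \<open>e * s\<close> while its parameter moves by about \<open>s\<close>, although the
        parameter is a \<open>norm c\<close>-Lipschitz function of the point. The choice of
        \<open>e\<close> gives \<open>(norm c + 1) * e = 1 - e < 1\<close>.\<close>
      have "\<tau> \<noteq> 0"
      proof
        assume "\<tau> = 0"
        define e where "e = 1 / (norm c + 2)"
        have e: "0 < e" "e * (norm c + 2) = 1" using add_pos_pos[OF c zero_less_numeral[of "num.Bit0 num.One"]] by (simp_all add: e_def)
        obtain d where d: "0 < d" "\<And>s. 0 < s \<Longrightarrow> s < d \<Longrightarrow>
            \<exists>t'\<in>T. norm (h t' - h t - (s * 1) *\<^sub>R \<tau>) \<le> e * s \<and> \<bar>t' - t - s * 1\<bar> \<le> e * s"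
          using \<tau>[THEN spec[of _ 1], THEN spec[of _ e]] e(1) by auto
        define s where "s = d / 2"
        have s: "0 < s" "s < d" using d(1) by (auto simp: s_def)
        obtain t' where t': "t' \<in> T" "norm (h t' - h t) \<le> e * s" "\<bar>t' - t - s\<bar> \<le> e * s"
          using d(2)[OF s] \<open>\<tau> = 0\<close> by auto
        obtain P' where P': "P' \<in> B" "t' = det2 c P'" using t'(1) by (auto simp: T_def)
        have "\<bar>t' - t\<bar> \<le> norm c * norm (h t' - h t)"
          using abs_det2_le[of c "P' - P"] by (simp add: P' t hP det2_diff t_def P)
        also have "\<dots> \<le> norm c * (e * s)" using t'(2) by (intro mult_left_mono) auto
        finally have "s \<le> norm c * (e * s) + e * s" using t'(3) by linarith
        also have "\<dots> = e * (norm c + 2) * s - e * s" by (simp add: algebra_simps)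
        also have "\<dots> = s - e * s" by (simp add: e(2))
        finally show False using mult_pos_pos[OF e(1) s(1)] by simp
      qed
      moreover have "P \<in> G" using P assms(1) by blast
      moreover have "(a *\<^sub>R u + b *\<^sub>R v) + l *\<^sub>R \<tau> \<notin> contingent G P" for l
      proof (rule contingent_avoids_strip[OF _ free bad(5)])
        fix l e :: real assume "0 < e"
        then obtain d where d: "0 < d" "\<forall>s. 0 < s \<and> s < d \<longrightarrow>
            (\<exists>t'\<in>T. norm (h t' - h t - (s * l) *\<^sub>R \<tau>) \<le> e * s \<and> \<bar>t' - t - s * l\<bar> \<le> e * s)"
          using \<tau> by blast
        have "\<exists>P'\<in>B. norm (P' - P - (s * l) *\<^sub>R \<tau>) \<le> e * s" if s: "0 < s" "s < d" for s
        proof -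
          obtain t' where t': "t' \<in> T" "norm (h t' - h t - (s * l) *\<^sub>R \<tau>) \<le> e * s" using d(2) s by blast
          obtain P' where "P' \<in> B" "t' = det2 c P'" using t'(1) by (auto simp: T_def)
          with t'(2) show ?thesis by (intro bexI[of _ P']) (simp_all add: t hP)
        qed
        with d(1) show "\<exists>d>0. \<forall>s. 0 < s \<and> s < d \<longrightarrow> (\<exists>P'\<in>B. norm (P' - P - (s * l) *\<^sub>R \<tau>) \<le> e * s)"
          by blast
      qed
      ultimately show False using contingent_half_plane bad(1-4) by blast
    qed
    then show "P \<in> h ` (T \<inter> N)" using t by blast
  qed
  moreover have "hausdorff1 (h ` (T \<inter> N)) = 0"
  proof (rule hausdorff1_lipschitz_image_null)
    show "negligible (T \<inter> N)" by (rule negligible_subset[OF N]) simp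
    show "M-lipschitz_on (T \<inter> N) h" by (rule lipschitz_on_subset[OF lip]) simp
  qed
  ultimately show ?thesis using hausdorff1_null_subset by blast
qed

text \<open>A missed combination \<open>a u + b v\<close> has a whole free cone around it. Shrinking
  the cone and moving its axis into a countable dense set leaves countably many pieces, each treated
  by the preceding lemma.\<close>

theorem hausdorff1_null_nonconvex_contingent:
  fixes G :: "(real \<times> real) set"
  shows "hausdorff1 {P \<in> G. \<not> convex (contingent G P)} = 0"
proof -
  obtain X :: "(real \<times> real) set" where X: "countable X" "\<And>Y. open Y \<Longrightarrow> Y \<noteq> {} \<Longrightarrow> \<exists>d\<in>X. d \<in> Y"
    by (rule countable_dense_setE) (assumption | rule that)+
  define r where "r n = 1 / real (Suc n)" for n
  have r: "0 < r n" for n by (simp add: r_def)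
  \<comment> \<open>A piece is localised near \<open>p\<close> with radius
    \<open>(r n)\<^sup>2 / 2\<close>, so that any two of its points are less than
    \<open>(r n)\<^sup>2\<close> apart.\<close>
  define B where "B = (\<lambda>(n, c, p). {P \<in> G. dist p P < (r n)\<^sup>2 / 2 \<and>
      (\<forall>Q\<in>G. \<forall>s. 0 < s \<and> s < r n \<longrightarrow> r n * s \<le> norm (Q - P - s *\<^sub>R c))})"
  define bad where "bad = (\<lambda>(n, c, p). {P \<in> B (n, c, p). \<exists>u\<in>contingent G P. \<exists>v\<in>contingent G P.
      \<exists>a\<ge>0. \<exists>b\<ge>0. dist (a *\<^sub>R u + b *\<^sub>R v) c < r n})"
  have null: "hausdorff1 (bad i) = 0" for i
  proof -
    obtain n c p where i: "i = (n, c, p)" by (cases i)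
    show ?thesis unfolding bad_def i prod.case
    proof (rule hausdorff1_null_cone_free_piece[OF _ r])
      show "B (n, c, p) \<subseteq> G" by (auto simp: B_def)
      show "r n * s \<le> norm (Q - P - s *\<^sub>R c)" if "P \<in> B (n, c, p)" "Q \<in> G" "0 < s" "s < r n" for P Q s
        using that by (simp add: B_def)
      show "norm (P' - P) < (r n)\<^sup>2" if "P \<in> B (n, c, p)" "P' \<in> B (n, c, p)" for P P'
      proof -
        have "dist p P < (r n)\<^sup>2 / 2" "dist p P' < (r n)\<^sup>2 / 2" using that by (auto simp: B_def)
        then have "dist P' P < (r n)\<^sup>2" using dist_triangle3[of P' P p] by linarith
        then show ?thesis by (simp add: dist_norm)
      qed
    qed
  qed
  have "hausdorff1 (\<Union>i\<in>UNIV \<times> X \<times> X. bad i) = 0"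
    using X(1) null by (intro hausdorff1_null_UN countable_SIGMA) auto
  moreover have "{P \<in> G. \<not> convex (contingent G P)} \<subseteq> (\<Union>i\<in>UNIV \<times> X \<times> X. bad i)"
  proof
    fix P assume "P \<in> {P \<in> G. \<not> convex (contingent G P)}"
    then have P: "P \<in> G" and "\<not> convex (contingent G P)" by auto
    then obtain u v a b where uv: "u \<in> contingent G P" "v \<in> contingent G P" and ab: "0 \<le> a" "0 \<le> b"
      and out: "a *\<^sub>R u + b *\<^sub>R v \<notin> contingent G P"
      unfolding convex_def by blast
    define c' where "c' = a *\<^sub>R u + b *\<^sub>R v"
    have "\<exists>e>0. \<forall>Q\<in>G. \<forall>s. 0 < s \<and> s < e \<longrightarrow> e * s \<le> norm (Q - P - s *\<^sub>R c')"
      using out unfolding contingent_def c'_def by (simp add: not_less) (meson not_le)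
    then obtain e where e: "0 < e" "\<And>Q s. Q \<in> G \<Longrightarrow> 0 < s \<Longrightarrow> s < e \<Longrightarrow> e * s \<le> norm (Q - P - s *\<^sub>R c')"
      by (elim exE conjE) blast
    \<comment> \<open>Half of \<open>e\<close> pays for moving the axis from \<open>c'\<close> to
      \<open>c\<close>, the other half is the opening of the new cone.\<close>
    obtain n where n: "r n < e / 2" using e(1) reals_Archimedean[of "e / 2"] by (auto simp: r_def inverse_eq_divide)
    obtain c where c: "c \<in> X" "dist c' c < r n" using X(2)[of "ball c' (r n)"] r[of n] by auto
    obtain p where p: "p \<in> X" "dist p P < (r n)\<^sup>2 / 2"
      using X(2)[of "ball P ((r n)\<^sup>2 / 2)"] r[of n] by (auto simp: dist_commute)
    have "r n * s \<le> norm (Q - P - s *\<^sub>R c)" if Q: "Q \<in> G" and s: "0 < s" "s < r n" for Q s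
    proof -
      have "e * s \<le> norm (Q - P - s *\<^sub>R c')" using Q s n e(1) by (intro e(2)) auto
      also have "Q - P - s *\<^sub>R c' = (Q - P - s *\<^sub>R c) - s *\<^sub>R (c' - c)" by (simp add: algebra_simps)
      also have "norm \<dots> \<le> norm (Q - P - s *\<^sub>R c) + norm (s *\<^sub>R (c' - c))" by (rule norm_triangle_ineq4)
      also have "norm (s *\<^sub>R (c' - c)) \<le> s * r n" using c(2) s(1) by (simp add: dist_norm)
      finally have "e * s \<le> norm (Q - P - s *\<^sub>R c) + s * r n" by simp
      moreover have "(r n + r n) * s \<le> e * s" using n s(1) by (intro mult_right_mono) auto
      ultimately show ?thesis by (simp add: distrib_right mult.commute)
    qed
    then have "P \<in> B (n, c, p)" using P p(2) by (simp add: B_def)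
    then have "P \<in> bad (n, c, p)" using uv ab c(2) unfolding bad_def c'_def by auto
    then show "P \<in> (\<Union>i\<in>UNIV \<times> X \<times> X. bad i)" using c(1) p(1) by blast
  qed
  ultimately show ?thesis by (rule hausdorff1_null_subset)
qed

section \<open>Differentiability at points of the graph\<close>

lemma graph_map_diff: "graph_map f x - graph_map f y = (x - y, f x - f y)"
  by (simp add: graph_map_def)

text \<open>Two limits in turn: with the left point \<open>Q\<close> fixed, letting the right point
  tend to \<open>y\<close> gives \<open>(Q - graph_map f y) \<bullet> v \<le> 0\<close>; this is
  linear in \<open>Q\<close> and passes to the left contingent. Both contingents are local, so only
  parameters within \<epsilon> of \<open>y\<close> matter.\<close>

lemma M1_point_contingent_inner:
  assumes "0 < \<epsilon>" and M1: "\<And>x z. x \<in> I \<inter> {y - \<epsilon><..<y} \<Longrightarrow> z \<in> I \<inter> {y<..<y + \<epsilon>} \<Longrightarrow>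
      norm (graph_map f x - graph_map f y) \<le> norm (graph_map f x - graph_map f z)"
    and u: "u \<in> contingent (graph_map f ` (I \<inter> {..<y})) (graph_map f y)"
    and v: "v \<in> contingent (graph_map f ` (I \<inter> {y<..})) (graph_map f y)"
  shows "u \<bullet> v \<le> 0"
proof -
  have near: "\<bar>x - y\<bar> < \<epsilon>" if "graph_map f x \<in> ball (graph_map f y) \<epsilon>" for x
  proof -
    have "norm (x - y) \<le> norm (graph_map f x - graph_map f y)"
      unfolding graph_map_diff by (rule norm_fst_le)
    then show ?thesis using that by (simp add: dist_norm norm_minus_commute)
  qed
  have "(Q - graph_map f y) \<bullet> v \<le> 0" if Q: "Q \<in> graph_map f ` (I \<inter> {..<y}) \<inter> ball (graph_map f y) \<epsilon>" for Q
  proof -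
    obtain x where x: "Q = graph_map f x" "x \<in> I \<inter> {y - \<epsilon><..<y}" using Q near by fastforce
    show ?thesis
    proof (rule inner_contingent_nonpos)
      show "v \<in> contingent (graph_map f ` (I \<inter> {y<..}) \<inter> ball (graph_map f y) \<epsilon>) (graph_map f y)"
        using v contingent_Int_ball[OF \<open>0 < \<epsilon>\<close>] by metis
      fix Q' assume Q': "Q' \<in> graph_map f ` (I \<inter> {y<..}) \<inter> ball (graph_map f y) \<epsilon>"
      obtain z where z: "Q' = graph_map f z" "z \<in> I \<inter> {y<..<y + \<epsilon>}" using Q' near by fastforce
      show "norm (Q - graph_map f y) \<le> norm (Q - graph_map f y - (Q' - graph_map f y))"
        using M1[OF x(2) z(2)] by (simp add: x(1) z(1))
    qed
  qed
  moreover have "u \<in> contingent (graph_map f ` (I \<inter> {..<y}) \<inter> ball (graph_map f y) \<epsilon>) (graph_map f y)"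
    using u contingent_Int_ball[OF \<open>0 < \<epsilon>\<close>] by metis
  ultimately show ?thesis
    by (rule contingent_half_space[OF bounded_linear_inner_left])
qed

lemma ex_unit_contingent:
  assumes "continuous_on I f" "y \<in> I" "y islimpt A" "A \<subseteq> I"
  shows "\<exists>w\<in>contingent (graph_map f ` A) (graph_map f y). norm w = 1"
proof -
  obtain X where X: "\<And>n::nat. X n \<in> A - {y}" "X \<longlonglongrightarrow> y"
    using assms(3) unfolding islimpt_sequential by blast
  have "(\<lambda>n. f (X n)) \<longlonglongrightarrow> f y"
    by (rule continuous_on_tendsto_compose[OF assms(1) X(2) assms(2)])
      (rule always_eventually, use X(1) assms(4) in blast)
  then have "(\<lambda>n. graph_map f (X n)) \<longlonglongrightarrow> graph_map f y"
    unfolding graph_map_def using X(2) by (intro tendsto_Pair)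
  moreover have "graph_map f (X n) \<in> graph_map f ` A" "graph_map f (X n) \<noteq> graph_map f y" for n
    using X(1)[of n] by (auto simp: graph_map_def)
  ultimately show ?thesis
    using contingent_subsequence[of "\<lambda>n. graph_map f (X n)" "graph_map f ` A" "graph_map f y"] by metis
qed

text \<open>The factor \<open>sgn (x - y)\<close> orients every secant to the right, so its first
  coordinate is positive and the slope is the ratio of the coordinates. A vertical limit makes the
  denominator tend to 0 from above, so the slope tends to infinity with the sign of
  \<open>snd w\<close>.\<close>

lemma deriv_point_if_directions_converge:
  assumes "y \<in> I" "norm w = 1"
    and lim: "((\<lambda>x. sgn (x - y) *\<^sub>R sgn (graph_map f x - graph_map f y)) \<longlongrightarrow> w) (at y within I)"
  shows "y \<in> deriv_points f I"
proof -
  define \<sigma> where "\<sigma> x = sgn (x - y) *\<^sub>R sgn (graph_map f x - graph_map f y)" for x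
  define F where "F = at y within I"
  have s1: "((\<lambda>x. fst (\<sigma> x)) \<longlongrightarrow> fst w) F" and s2: "((\<lambda>x. snd (\<sigma> x)) \<longlongrightarrow> snd w) F"
    using lim unfolding \<sigma>_def[symmetric] F_def by (auto intro: tendsto_fst tendsto_snd)
  have ne: "\<forall>\<^sub>F x in F. x \<noteq> y" unfolding F_def by (simp add: eventually_neq_at_within)
  have pos: "0 < fst (\<sigma> x)" and quot: "(f x - f y) / (x - y) = snd (\<sigma> x) / fst (\<sigma> x)" if "x \<noteq> y" for x
  proof -
    define n where "n = norm (graph_map f x - graph_map f y)"
    have "0 < n" using that by (simp add: n_def graph_map_diff zero_prod_def)
    have \<sigma>: "fst (\<sigma> x) = sgn (x - y) * ((x - y) / n)" "snd (\<sigma> x) = sgn (x - y) * ((f x - f y) / n)"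
      unfolding \<sigma>_def sgn_div_norm n_def[symmetric] by (simp_all add: graph_map_diff divide_inverse_commute)
    show "0 < fst (\<sigma> x)" using \<open>0 < n\<close> that by (simp add: \<sigma> sgn_if zero_less_divide_iff)
    show "(f x - f y) / (x - y) = snd (\<sigma> x) / fst (\<sigma> x)"
      unfolding \<sigma> using \<open>0 < n\<close> that by (simp add: sgn_if)
  qed
  have ev: "\<forall>\<^sub>F x in F. snd (\<sigma> x) / fst (\<sigma> x) = (f x - f y) / (x - y)"
    using ne by eventually_elim (simp add: quot)
  have evpos: "\<forall>\<^sub>F x in F. 0 < fst (\<sigma> x)"
    using ne by eventually_elim (simp add: pos)
  show ?thesis
  proof (cases "fst w = 0")
    case False
    have "((\<lambda>x. snd (\<sigma> x) / fst (\<sigma> x)) \<longlongrightarrow> snd w / fst w) F"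
      using s2 s1 False by (rule tendsto_divide)
    then have "((\<lambda>x. (f x - f y) / (x - y)) \<longlongrightarrow> snd w / fst w) F"
      using ev by (rule Lim_transform_eventually)
    then have "(f has_real_derivative snd w / fst w) (at y within I)"
      unfolding has_field_derivative_iff F_def .
    then show ?thesis using assms(1) unfolding deriv_points_def by blast
  next
    case True
    have "snd w \<noteq> 0" using assms(2) True by (metis norm_zero prod_eq_iff zero_neq_one zero_prod_def fst_conv snd_conv)
    then consider "0 < snd w" | "0 < - snd w" by linarith
    then show ?thesis
    proof cases
      case 1
      have "filterlim (\<lambda>x. snd (\<sigma> x) / fst (\<sigma> x)) at_top F"
        using LIM_at_top_divide[OF s2 1 _ evpos] s1 True by simp
      then have "filterlim (\<lambda>x. (f x - f y) / (x - y)) at_top F"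
        using filterlim_cong[OF refl refl ev] by blast
      then show ?thesis using assms(1) unfolding deriv_points_def F_def by blast
    next
      case 2
      have "filterlim (\<lambda>x. - snd (\<sigma> x) / fst (\<sigma> x)) at_top F"
        using LIM_at_top_divide[OF tendsto_minus[OF s2] 2 _ evpos] s1 True by simp
      then have "filterlim (\<lambda>x. snd (\<sigma> x) / fst (\<sigma> x)) at_bot F"
        by (simp add: filterlim_uminus_at_bot)
      then have "filterlim (\<lambda>x. (f x - f y) / (x - y)) at_bot F"
        using filterlim_cong[OF refl refl ev] by blast
      then show ?thesis using assms(1) unfolding deriv_points_def F_def by blast
    qed
  qed
qed

lemma M1_point_deriv_point:
  assumes I: "is_interval I" and cont: "continuous_on I f" and y: "y \<in> M1_points f I"
    and x0: "x0 \<in> I" "x0 < y" and z0: "z0 \<in> I" "y < z0"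
    and conv: "convex (contingent (graph_map f ` I) (graph_map f y))"
  shows "y \<in> deriv_points f I"
proof -
  define \<psi> where "\<psi> = graph_map f"
  define L where "L = contingent (\<psi> ` (I \<inter> {..<y})) (\<psi> y)"
  define R where "R = contingent (\<psi> ` (I \<inter> {y<..})) (\<psi> y)"
  have yI: "y \<in> I" using y by (simp add: M1_points_def)
  have "\<exists>\<epsilon>>0. \<forall>x\<in>I \<inter> {y - \<epsilon><..<y}. \<forall>z\<in>I \<inter> {y<..<y + \<epsilon>}.
      norm (graph_map f x - graph_map f y) \<le> norm (graph_map f x - graph_map f z)"
    using y unfolding M1_points_def by simp
  then obtain \<epsilon> where \<epsilon>: "0 < \<epsilon>" "\<And>x z. x \<in> I \<inter> {y - \<epsilon><..<y} \<Longrightarrow> z \<in> I \<inter> {y<..<y + \<epsilon>} \<Longrightarrow>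
      norm (graph_map f x - graph_map f y) \<le> norm (graph_map f x - graph_map f z)"
    by (elim exE conjE) blast
  have dot: "u \<bullet> v \<le> 0" if "u \<in> L" "v \<in> R" for u v
    by (rule M1_point_contingent_inner[OF \<epsilon>]) (use that in \<open>simp_all add: L_def R_def \<psi>_def\<close>)
  have between: "x \<in> I" if "a \<in> I" "b \<in> I" "a \<le> x" "x \<le> b" for a b x
    using I that unfolding is_interval_1 by blast
  have "{x0<..<y} \<subseteq> I \<inter> {..<y}" using between[OF x0(1) yI] by auto
  then have "y islimpt I \<inter> {..<y}"
    by (rule islimpt_subset[OF islimpt_greaterThanLessThan2[OF x0(2)]])
  from ex_unit_contingent[OF cont yI this Int_lower1]
  obtain u where u: "u \<in> L" "norm u = 1" unfolding L_def \<psi>_def by blast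
  have "{y<..<z0} \<subseteq> I \<inter> {y<..}" using between[OF yI z0(1)] by auto
  then have "y islimpt I \<inter> {y<..}"
    by (rule islimpt_subset[OF islimpt_greaterThanLessThan1[OF z0(2)]])
  from ex_unit_contingent[OF cont yI this Int_lower1]
  obtain v where v: "v \<in> R" "norm v = 1" unfolding R_def \<psi>_def by blast
  \<comment> \<open>The base point is not on the left part of the graph, so 0 is obtained as a limit
    of multiples of \<open>u\<close> in the closed cone \<open>L\<close>. It absorbs the
    contribution of the single point \<open>\<psi> y\<close>.\<close>
  have zero: "0 \<in> L"
  proof -
    have "(\<lambda>n. (1 / real (Suc n)) *\<^sub>R u) \<longlonglongrightarrow> 0 *\<^sub>R u"
      by (intro tendsto_scaleR tendsto_const LIMSEQ_inverse_real_of_nat[unfolded inverse_eq_divide])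
    moreover have "(1 / real (Suc n)) *\<^sub>R u \<in> L" for n
      using u(1) unfolding L_def by (intro contingent_scaleR) auto
    ultimately show ?thesis
      using closed_sequentially[of L "\<lambda>n. (1 / real (Suc n)) *\<^sub>R u" 0] by (simp add: L_def closed_contingent)
  qed
  have "I = I \<inter> {..<y} \<union> I \<inter> {y<..} \<union> {y}" using yI by auto
  then have "\<psi> ` I = \<psi> ` (I \<inter> {..<y}) \<union> \<psi> ` (I \<inter> {y<..}) \<union> {\<psi> y}"
    by (metis image_Un image_empty image_insert)
  then have "contingent (\<psi> ` I) (\<psi> y) = L \<union> R \<union> contingent {\<psi> y} (\<psi> y)"
    by (simp only: contingent_Un L_def R_def)
  then have "contingent (\<psi> ` I) (\<psi> y) = L \<union> R" using contingent_singleton zero by blast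
  then have "convex (L \<union> R)" using conv by (simp add: \<psi>_def)
  moreover have "closed L" "closed R" by (simp_all add: L_def R_def closed_contingent)
  ultimately have opp: "v' = - u'" if "u' \<in> L" "norm u' = 1" "v' \<in> R" "norm v' = 1" for u' v'
    using opposite_if_convex_Un[OF _ _ _ dot that] by simp
  have cont\<psi>: "(\<psi> \<longlongrightarrow> \<psi> y) (at y within A)" if "A \<subseteq> I" for A
  proof -
    have "(f \<longlongrightarrow> f y) (at y within I)" using cont yI by (simp add: continuous_on)
    then have "(f \<longlongrightarrow> f y) (at y within A)" using that by (rule tendsto_within_subset)
    then show ?thesis unfolding \<psi>_def graph_map_def by (intro tendsto_Pair tendsto_ident_at)
  qed
  have "((\<lambda>x. sgn (\<psi> x - \<psi> y)) \<longlongrightarrow> - v) (at y within I \<inter> {..<y})"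
  proof (rule tendsto_sgn_unique_contingent[OF cont\<psi>])
    show "w = - v" if "w \<in> contingent (\<psi> ` (I \<inter> {..<y})) (\<psi> y)" "norm w = 1" for w
      using opp[OF _ that(2) v] that(1) by (simp add: L_def)
  qed (auto simp: \<psi>_def graph_map_def)
  then have l: "((\<lambda>x. - sgn (\<psi> x - \<psi> y)) \<longlongrightarrow> v) (at y within I \<inter> {..<y})"
    using tendsto_minus[of "\<lambda>x. sgn (\<psi> x - \<psi> y)" "- v"] by simp
  have r: "((\<lambda>x. sgn (\<psi> x - \<psi> y)) \<longlongrightarrow> v) (at y within I \<inter> {y<..})"
  proof (rule tendsto_sgn_unique_contingent[OF cont\<psi>])
    \<comment> \<open>Both \<open>w\<close> and \<open>v\<close> are opposite to the same unit
      vector \<open>u\<close> of \<open>L\<close>.\<close>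
    show "w = v" if "w \<in> contingent (\<psi> ` (I \<inter> {y<..})) (\<psi> y)" "norm w = 1" for w
      using opp[OF u, of w] opp[OF u v] that by (simp add: R_def)
  qed (auto simp: \<psi>_def graph_map_def)
  let ?\<sigma> = "\<lambda>x. sgn (x - y) *\<^sub>R sgn (\<psi> x - \<psi> y)"
  have "(?\<sigma> \<longlongrightarrow> v) (at y within I \<inter> {..<y})"
    by (rule Lim_transform_within[OF l zero_less_one]) auto
  moreover have "(?\<sigma> \<longlongrightarrow> v) (at y within I \<inter> {y<..})"
    by (rule Lim_transform_within[OF r zero_less_one]) auto
  ultimately have "(?\<sigma> \<longlongrightarrow> v) (at y within (I \<inter> {..<y}) \<union> (I \<inter> {y<..}))"
    unfolding Lim_within_Un by blast
  moreover have "(I \<inter> {..<y}) \<union> (I \<inter> {y<..}) = I - {y}" by auto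
  moreover have "at y within (I - {y}) = at y within I" unfolding at_within_def by simp
  ultimately have "(?\<sigma> \<longlongrightarrow> v) (at y within I)" by simp
  then show ?thesis
    using deriv_point_if_directions_converge[OF yI v(2)] by (simp add: \<psi>_def)
qed

text \<open>For the chords \<open>a\<close>, \<open>b\<close> from \<open>y\<close> to points on its
  two sides, \<open>a \<bullet> b = (x - y) * (z - y) * (1 + q x * q z)\<close>, so
  \<open>a \<bullet> b \<le> 0\<close> follows from \<open>q x * q z \<ge> -1\<close>. Near
  \<open>y\<close> this product is close to \<open>d\<^sup>2\<close> for a finite derivative
  \<open>d\<close>, and nonnegative for an infinite one.\<close>

lemma deriv_points_subset_M1_points: "deriv_points f I \<subseteq> M1_points f I"
proof
  fix y assume y: "y \<in> deriv_points f I"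
  define q where "q x = (f x - f y) / (x - y)" for x
  have "\<exists>\<epsilon>>0. \<forall>x\<in>I. \<forall>z\<in>I. x \<noteq> y \<and> z \<noteq> y \<and> \<bar>x - y\<bar> < \<epsilon> \<and> \<bar>z - y\<bar> < \<epsilon> \<longrightarrow> - 1 \<le> q x * q z"
  proof -
    have *: ?thesis if "\<forall>\<^sub>F x in at y within I. S (q x)" "\<And>a b. S a \<Longrightarrow> S b \<Longrightarrow> - 1 \<le> a * b" for S
      using that unfolding eventually_at dist_real_def by metis
    consider d where "(f has_real_derivative d) (at y within I)"
      | "filterlim q at_top (at y within I)" | "filterlim q at_bot (at y within I)"
      using y unfolding deriv_points_def q_def by blast
    then show ?thesis
    proof cases
      case (1 d)
      then have lim: "(q \<longlongrightarrow> d) (at y within I)" by (simp add: has_field_derivative_iff q_def[abs_def])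
      \<comment> \<open>Expanding \<open>a * b\<close> around \<open>d * d\<close> leaves two errors
        of at most \<open>\<eta> * \<bar>d\<bar>\<close> and one of at most \<open>\<eta>\<close>,
        in total 1.\<close>
      define \<eta> where "\<eta> = 1 / (2 * \<bar>d\<bar> + 1)"
      have \<eta>: "0 < \<eta>" "\<eta> * (2 * \<bar>d\<bar> + 1) = 1" by (simp_all add: \<eta>_def add_nonneg_pos add_nonneg_eq_0_iff)
      have \<eta>1: "\<eta> \<le> 1" by (simp add: \<eta>_def)
      have "\<forall>\<^sub>F x in at y within I. \<bar>q x - d\<bar> < \<eta>" using tendstoD[OF lim \<eta>(1)] by (simp add: dist_real_def)
      then show ?thesis
      proof (rule *)
        fix a b assume ab: "\<bar>a - d\<bar> < \<eta>" "\<bar>b - d\<bar> < \<eta>"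
        have "a * b = d * d + (a - d) * d + d * (b - d) + (a - d) * (b - d)" by (simp add: algebra_simps)
        moreover have "\<bar>(a - d) * d\<bar> \<le> \<eta> * \<bar>d\<bar>"
          unfolding abs_mult using ab(1) by (intro mult_right_mono) auto
        moreover have "\<bar>d * (b - d)\<bar> \<le> \<eta> * \<bar>d\<bar>"
          unfolding abs_mult mult.commute[of "\<bar>d\<bar>"] using ab(2) by (intro mult_right_mono) auto
        moreover have "\<bar>(a - d) * (b - d)\<bar> \<le> \<eta> * 1"
          unfolding abs_mult using ab \<eta>1 \<eta>(1) by (intro mult_mono) linarith+
        moreover have "\<eta> * \<bar>d\<bar> + \<eta> * \<bar>d\<bar> + \<eta> * 1 = 1" using \<eta>(2) by (simp add: algebra_simps)
        moreover have "0 \<le> d * d" by simp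
        ultimately show "- 1 \<le> a * b" by linarith
      qed
    next
      case 2
      then have "\<forall>\<^sub>F x in at y within I. 0 \<le> q x" by (simp add: filterlim_at_top)
      then show ?thesis by (rule *) (simp add: order_trans[of "-1" 0])
    next
      case 3
      then have "\<forall>\<^sub>F x in at y within I. q x \<le> 0" by (simp add: filterlim_at_bot)
      then show ?thesis by (rule *) (simp add: order_trans[of "-1" 0] mult_nonpos_nonpos)
    qed
  qed
  then obtain \<epsilon> where \<epsilon>: "0 < \<epsilon>" "\<And>x z. x \<in> I \<Longrightarrow> z \<in> I \<Longrightarrow> x \<noteq> y \<Longrightarrow> z \<noteq> y \<Longrightarrow> \<bar>x - y\<bar> < \<epsilon> \<Longrightarrow> \<bar>z - y\<bar> < \<epsilon> \<Longrightarrow> - 1 \<le> q x * q z"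
    by blast
  have "norm (graph_map f x - graph_map f y) \<le> norm (graph_map f x - graph_map f z)"
    if x: "x \<in> I \<inter> {y - \<epsilon><..<y}" and z: "z \<in> I \<inter> {y<..<y + \<epsilon>}" for x z
  proof -
    have q: "- 1 \<le> q x * q z" using x z by (intro \<epsilon>(2)) auto
    have fx: "f x - f y = q x * (x - y)" "f z - f y = q z * (z - y)" using x z by (auto simp: q_def)
    define a b where "a = graph_map f x - graph_map f y" and "b = graph_map f z - graph_map f y"
    have "a \<bullet> b = (x - y) * (z - y) * (1 + q x * q z)"
      by (simp add: a_def b_def graph_map_diff fx inner_prod_def algebra_simps)
    moreover have "(x - y) * (z - y) \<le> 0" using x z by (intro mult_nonpos_nonneg) auto
    ultimately have "a \<bullet> b \<le> 0" using q by (simp add: mult_nonpos_nonneg)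
    then have "2 * (a \<bullet> b) \<le> b \<bullet> b" using inner_ge_zero[of b] by linarith
    then have "a \<bullet> a \<le> (a - b) \<bullet> (a - b)"
      by (simp add: inner_diff_left inner_diff_right inner_commute)
    then have "norm a \<le> norm (a - b)" by (simp add: norm_le)
    then show ?thesis by (simp add: a_def b_def)
  qed
  then show "y \<in> M1_points f I"
    using y \<epsilon>(1) unfolding M1_points_def deriv_points_def by blast
qed

lemma hausdorff1_null_countable:
  assumes "countable A"
  shows "hausdorff1 A = 0"
proof -
  have "hausdorff1 ((\<lambda>_::real. P) ` {0}) = 0" for P
    by (rule hausdorff1_lipschitz_image_null[of _ 0]) (auto simp: lipschitz_on_def)
  then have "hausdorff1 (\<Union>P\<in>A. {P}) = 0"
    by (intro hausdorff1_null_UN assms) simp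
  then show ?thesis by simp
qed

theorem theorem6p3:
  fixes f :: "real \<Rightarrow> real" and I :: "real set"
  assumes "is_interval I" and "\<exists>a b. a \<in> I \<and> b \<in> I \<and> a < b"
    and "continuous_on I f"
  shows "\<exists>E \<subseteq> I. hausdorff1 (graph_map f ` E) = 0 \<and>
           deriv_points f I \<subseteq> M1_points f I \<and>
           M1_points f I \<subseteq> deriv_points f I \<union> E"
proof -
  let ?K = "\<lambda>y. contingent (graph_map f ` I) (graph_map f y)"
  define nonconvex where "nonconvex = {y \<in> I. \<not> convex (?K y)}"
  \<comment> \<open>At an endpoint of \<open>I\<close> the M1 condition is vacuous and one side has
    no graph points. Each of the two sets has at most one element.\<close>
  define endpoints where "endpoints = {y \<in> I. \<forall>x\<in>I. y \<le> x} \<union> {y \<in> I. \<forall>x\<in>I. x \<le> y}"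
  have "hausdorff1 (graph_map f ` nonconvex) = 0"
    by (rule hausdorff1_null_subset[OF hausdorff1_null_nonconvex_contingent[of "graph_map f ` I"]])
      (auto simp: nonconvex_def)
  moreover have "hausdorff1 (graph_map f ` endpoints) = 0"
  proof (rule hausdorff1_null_countable, rule countable_image)
    have "countable {y \<in> I. \<forall>x\<in>I. y \<le> x}"
      by (rule countable_subset[of _ "{LEAST y. y \<in> I}"]) (auto intro!: Least_equality[symmetric])
    moreover have "countable {y \<in> I. \<forall>x\<in>I. x \<le> y}"
      by (rule countable_subset[of _ "{GREATEST y. y \<in> I}"]) (auto intro!: Greatest_equality[symmetric])
    ultimately show "countable endpoints" unfolding endpoints_def by (rule countable_Un)
  qed
  ultimately have "hausdorff1 (graph_map f ` (nonconvex \<union> endpoints)) = 0"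
    unfolding image_Un by (rule hausdorff1_null_Un)
  moreover have "M1_points f I \<subseteq> deriv_points f I \<union> (nonconvex \<union> endpoints)"
  proof
    fix y assume y: "y \<in> M1_points f I"
    show "y \<in> deriv_points f I \<union> (nonconvex \<union> endpoints)"
    proof (cases "y \<in> nonconvex \<union> endpoints")
      case False
      have "y \<in> I" using y by (simp add: M1_points_def)
      with False have conv: "convex (?K y)" by (simp add: nonconvex_def)
      obtain x0 z0 where "x0 \<in> I" "x0 < y" "z0 \<in> I" "y < z0"
        using False \<open>y \<in> I\<close> by (auto simp: endpoints_def not_le)
      then show ?thesis
        using M1_point_deriv_point[OF assms(1,3) y _ _ _ _ conv] by blast
    qed simp
  qed
  moreover have "nonconvex \<union> endpoints \<subseteq> I" by (auto simp: nonconvex_def endpoints_def)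
  ultimately show ?thesis
    using deriv_points_subset_M1_points[of f I] by (intro exI[of _ "nonconvex \<union> endpoints"]) simp
qed

end
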